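(* Let $(X,d)$ be a locally compact, geodesically complete CAT(0)-space connected at infinity, and let $d'$ be a metric on $X$ such that $(X,d')$ is a locally compact geodesically complete CAT(0)-space and $d(x,y)\le1\iff d'(x,y)\le1$ for all $x,y\in X$. Let $c\colon(-\infty,+\infty)\to X$ be a complete geodesic of $(X,d)$ which bounds a flat strip in $(X,d)$. Then $c$ is a geodesic bounding a flat strip with respect to $d'$ as well, and $d'(c(t_1),c(t_2))=d(c(t_1),c(t_2))$ for all $t_1,t_2\in\mathbb R$.
   Context: A flat strip is a subset isometric to a strip $\mathbb R\times[0,w]$, $w>0$, in the Euclidean plane; a complete geodesic bounds a flat strip if it is one of the two boundary lines of such a subset. Geodesically complete: geodesic and every geodesic segment lies in a complete geodesic; connected at infinity: complement of every metric ball path connected. *)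

theory Defs
  imports "HOL-Analysis.Analysis"
begin

definition geod_seg :: "'a set \<Rightarrow> ('a \<Rightarrow> 'a \<Rightarrow> real) \<Rightarrow> (real \<Rightarrow> 'a) \<Rightarrow> 'a \<Rightarrow> 'a \<Rightarrow> bool" where
  "geod_seg X d g x y \<longleftrightarrow> g 0 = x \<and> g (d x y) = y \<and> (\<forall>s\<in>{0..d x y}. g s \<in> X) \<and>
     (\<forall>s\<in>{0..d x y}. \<forall>t\<in>{0..d x y}. d (g s) (g t) = \<bar>s - t\<bar>)"

definition geod_on :: "'a set \<Rightarrow> ('a \<Rightarrow> 'a \<Rightarrow> real) \<Rightarrow> (real \<Rightarrow> 'a) \<Rightarrow> real \<Rightarrow> real \<Rightarrow> bool" where
  "geod_on X d g a b \<longleftrightarrow> (\<forall>s\<in>{a..b}. g s \<in> X) \<and>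
     (\<forall>s\<in>{a..b}. \<forall>t\<in>{a..b}. d (g s) (g t) = \<bar>s - t\<bar>)"

definition complete_geodesic :: "'a set \<Rightarrow> ('a \<Rightarrow> 'a \<Rightarrow> real) \<Rightarrow> (real \<Rightarrow> 'a) \<Rightarrow> bool" where
  "complete_geodesic X d c \<longleftrightarrow> (\<forall>t. c t \<in> X) \<and> (\<forall>s t. d (c s) (c t) = \<bar>s - t\<bar>)"

definition geodesic_space :: "'a set \<Rightarrow> ('a \<Rightarrow> 'a \<Rightarrow> real) \<Rightarrow> bool" where
  "geodesic_space X d \<longleftrightarrow> Metric_space X d \<and> (\<forall>x\<in>X. \<forall>y\<in>X. \<exists>g. geod_seg X d g x y)"

definition geodesically_complete :: "'a set \<Rightarrow> ('a \<Rightarrow> 'a \<Rightarrow> real) \<Rightarrow> bool" where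
  "geodesically_complete X d \<longleftrightarrow> geodesic_space X d \<and>
     (\<forall>g a b. a < b \<longrightarrow> geod_on X d g a b \<longrightarrow>
        (\<exists>c. complete_geodesic X d c \<and> (\<forall>t\<in>{a..b}. c t = g t)))"

text \<open>Pairs (point on a side of a geodesic triangle, corresponding point on the
  side of the Euclidean comparison triangle in the plane (complex numbers)).\<close>
definition side_pts :: "('a \<Rightarrow> 'a \<Rightarrow> real) \<Rightarrow> (real \<Rightarrow> 'a) \<Rightarrow> 'a \<Rightarrow> 'a \<Rightarrow> complex \<Rightarrow> complex \<Rightarrow> ('a \<times> complex) set" where
  "side_pts d g x y p q = {(g s, p + (s / d x y) *\<^sub>R (q - p)) | s. s \<in> {0..d x y}}"

definition CAT0 :: "'a set \<Rightarrow> ('a \<Rightarrow> 'a \<Rightarrow> real) \<Rightarrow> bool" where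
  "CAT0 X d \<longleftrightarrow> geodesic_space X d \<and>
     (\<forall>x\<in>X. \<forall>y\<in>X. \<forall>z\<in>X. \<forall>g1 g2 g3 p q r.
        geod_seg X d g1 x y \<longrightarrow> geod_seg X d g2 y z \<longrightarrow> geod_seg X d g3 z x \<longrightarrow>
        dist p q = d x y \<longrightarrow> dist q r = d y z \<longrightarrow> dist r p = d z x \<longrightarrow>
        (let T = side_pts d g1 x y p q \<union> side_pts d g2 y z q r \<union> side_pts d g3 z x r p in
          \<forall>u\<in>T. \<forall>v\<in>T. d (fst u) (fst v) \<le> dist (snd u) (snd v)))"

definition locally_compact_metric :: "'a set \<Rightarrow> ('a \<Rightarrow> 'a \<Rightarrow> real) \<Rightarrow> bool" where
  "locally_compact_metric X d \<longleftrightarrow> locally_compact_space (Metric_space.mtopology X d)"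

definition connected_at_infinity :: "'a set \<Rightarrow> ('a \<Rightarrow> 'a \<Rightarrow> real) \<Rightarrow> bool" where
  "connected_at_infinity X d \<longleftrightarrow>
     (\<forall>x\<in>X. \<forall>r. path_connectedin (Metric_space.mtopology X d) (X - Metric_space.mball X d x r))"

text \<open>A complete geodesic c bounds a flat strip: there is w > 0 and an isometric embedding
  f of the Euclidean strip R x [0,w] into X one of whose boundary lines is the image of c.
  (Product dist on real x real is the Euclidean distance.)\<close>
definition bounds_flat_strip :: "'a set \<Rightarrow> ('a \<Rightarrow> 'a \<Rightarrow> real) \<Rightarrow> (real \<Rightarrow> 'a) \<Rightarrow> bool" where
  "bounds_flat_strip X d c \<longleftrightarrow> complete_geodesic X d c \<and>
     (\<exists>w>0. \<exists>f :: real \<times> real \<Rightarrow> 'a.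
        (\<forall>p\<in>(UNIV \<times> {0..w}). f p \<in> X) \<and>
        (\<forall>p\<in>(UNIV \<times> {0..w}). \<forall>q\<in>(UNIV \<times> {0..w}). d (f p) (f q) = dist p q) \<and>
        (range c = (\<lambda>t. f (t, 0)) ` UNIV \<or> range c = (\<lambda>t. f (t, w)) ` UNIV))"

end

theory Submission
  imports Defs "HOL-Real_Asymp.Real_Asymp"
begin

text \<open>
  Chains of unit steps show that \<open>d \<le> n\<close> iff \<open>d' \<le> n\<close> for every natural \<open>n\<close>. The identity is a
  homeomorphism between the two metrics, so \<open>d = n\<close> iff \<open>d' = n\<close> as well, and a sequence
  \<open>(x\<^sub>i)\<close>, \<open>i \<in> \<int>\<close>, with \<open>d x\<^sub>i x\<^sub>j = \<bar>i - j\<bar>\<close> is of the same kind for \<open>d'\<close>. Hence the union \<open>P\<close> of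
  the lines parallel to \<open>c\<close> is the same set for both metrics. By the flat strip theorem \<open>P\<close> is a
  product of a line (coordinate \<open>h\<close>) and a geodesic transversal space (distance \<open>a\<close>), and both
  product structures have the same unit translation along the lines.

  Comparing distances with large integers, after integer translations, shows \<open>h' = \<phi> \<circ> h\<close> with
  \<open>\<phi>\<close> increasing. For points whose heights differ by \<open>e\<close>, the condition \<open>a \<le> sqrt (2 e - e\<^sup>2)\<close>
  means that one of them is at distance at most 1 from a unit translate of the other, so it is
  preserved. Joining points of the same height by short zigzags it follows that \<open>a' = \<kappa> a\<close> on the
  slice of height \<open>x\<close>, where \<open>\<kappa>\<^sup>2 = \<phi>' x\<close>. The factor does not depend on \<open>x\<close>: it is 1 if \<open>a\<close> takes
  values above 1, and otherwise it is the quotient of the diameters of the transversal spaces.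
  Since \<open>\<phi> (x + 1) = \<phi> x + 1\<close>, it equals 1, and \<open>\<phi>\<close> is a translation. Finally the \<open>d\<close>-lines are
  \<open>d'\<close>-vertical, because arbitrarily small transversal balls around two points of such a line
  coincide. So \<open>d = d'\<close> on \<open>P\<close>, which contains the flat strip.
\<close>

section \<open>Comparison geometry\<close>

lemma comparison_triangle_exists:
  fixes A B C :: real
  assumes "0 \<le> A" "0 \<le> B" "0 \<le> C" "A \<le> B + C" "B \<le> C + A" "C \<le> A + B"
  shows "\<exists>p q r::complex. dist p q = A \<and> dist q r = B \<and> dist r p = C"
proof (cases "A = 0")
  case True
  with assms have "B = C" by simp
  then show ?thesis
    using True assms by (intro exI[of _ 0] exI[of _ 0] exI[of _ "complex_of_real B"]) simp
next
  case False
  with assms have A: "A > 0" by simp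
  define x where "x = (C\<^sup>2 + A\<^sup>2 - B\<^sup>2) / (2 * A)"
  have x: "2 * A * x = C\<^sup>2 + A\<^sup>2 - B\<^sup>2" using A by (simp add: x_def)
  \<comment> \<open>Heron's factorisation: each factor is nonnegative by a triangle inequality,
    hence so is the squared ordinate of the third vertex, whose abscissa \<open>x\<close> comes from
    the law of cosines.\<close>
  have "0 \<le> ((C + A) - B) * ((C + A) + B) * ((B - (C - A)) * (B + (C - A)))"
    using assms by (intro mult_nonneg_nonneg) auto
  also have "\<dots> = (2 * A * C)\<^sup>2 - (C\<^sup>2 + A\<^sup>2 - B\<^sup>2)\<^sup>2"
    by (simp add: power2_eq_square algebra_simps)
  also have "\<dots> = (2 * A)\<^sup>2 * (C\<^sup>2 - x\<^sup>2)"
    unfolding x[symmetric] by (simp add: power_mult_distrib algebra_simps)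
  finally have nn: "0 \<le> C\<^sup>2 - x\<^sup>2" using A by (simp add: zero_le_mult_iff)
  define r where "r = Complex x (sqrt (C\<^sup>2 - x\<^sup>2))"
  have 1: "dist r 0 = C" using nn assms by (simp add: r_def cmod_def)
  have "(A - x)\<^sup>2 + (C\<^sup>2 - x\<^sup>2) = B\<^sup>2"
    using x by (simp add: power2_eq_square algebra_simps)
  then have 2: "dist (complex_of_real A) r = B"
    using nn assms by (simp add: r_def dist_norm cmod_def)
  show ?thesis
    using 1 2 A by (intro exI[of _ 0] exI[of _ "complex_of_real A"] exI[of _ r]) auto
qed

text \<open>Stewart's theorem.\<close>

lemma dist_segment_point_squared:
  fixes p q r :: "'b::real_inner"
  shows "(dist r (p + l *\<^sub>R (q - p)))\<^sup>2 =
    (1 - l) * (dist r p)\<^sup>2 + l * (dist r q)\<^sup>2 - l * (1 - l) * (dist p q)\<^sup>2"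
  by (simp add: dist_norm power2_norm_eq_inner algebra_simps inner_commute)

locale cat0 = Metric_space X d for X :: "'a set" and d +
  assumes CAT0: "CAT0 X d"
begin

lemma geodesic_exists:
  assumes "x \<in> X" "y \<in> X"
  obtains g where "geod_seg X d g x y"
  using CAT0 assms unfolding CAT0_def geodesic_space_def by blast

lemma point_between:
  assumes "x \<in> X" "y \<in> X" "0 \<le> l" "l \<le> 1"
  obtains m where "m \<in> X" "d x m = l * d x y" "d m y = (1 - l) * d x y"
proof -
  obtain g where g: "geod_seg X d g x y" using geodesic_exists assms by blast
  have m: "l * d x y \<in> {0..d x y}" using assms by (auto intro: mult_left_le_one_le)
  have ends: "0 \<in> {0..d x y}" "d x y \<in> {0..d x y}" by auto
  have "d (g 0) (g (l * d x y)) = \<bar>0 - l * d x y\<bar>"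
    using g m ends unfolding geod_seg_def by blast
  moreover have "d (g (l * d x y)) (g (d x y)) = \<bar>l * d x y - d x y\<bar>"
    using g m ends unfolding geod_seg_def by blast
  moreover have "g (l * d x y) \<in> X" "g 0 = x" "g (d x y) = y"
    using g m unfolding geod_seg_def by blast+
  ultimately show ?thesis using m assms by (intro that[of "g (l * d x y)"]) (auto simp: algebra_simps)
qed

lemma comparison_geodesic:
  assumes "x \<in> X" "y \<in> X" "z \<in> X" "geod_seg X d g x y" "0 \<le> l" "l \<le> 1"
  shows "(d z (g (l * d x y)))\<^sup>2 \<le> (1 - l) * (d z x)\<^sup>2 + l * (d z y)\<^sup>2 - l * (1 - l) * (d x y)\<^sup>2"
proof -
  obtain g2 where g2: "geod_seg X d g2 y z" using geodesic_exists assms by blast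
  obtain g3 where g3: "geod_seg X d g3 z x" using geodesic_exists assms by blast
  have "d x y \<le> d y z + d z x" "d y z \<le> d z x + d x y" "d z x \<le> d x y + d y z"
    using assms triangle commute by (metis add.commute)+
  then obtain p q r :: complex where tr: "dist p q = d x y" "dist q r = d y z" "dist r p = d z x"
    using comparison_triangle_exists[of "d x y" "d y z" "d z x"] by auto
  define s where "s = l * d x y"
  have s: "s \<in> {0..d x y}" using assms by (auto simp: s_def intro: mult_left_le_one_le)
  have u: "(g s, p + (s / d x y) *\<^sub>R (q - p)) \<in> side_pts d g x y p q"
    using s unfolding side_pts_def by blast
  have "g2 (d y z) = z" using g2 unfolding geod_seg_def by blast
  \<comment> \<open>For \<open>d y z = 0\<close> the quotient is 0 by convention, but then
    \<open>q = r\<close>.\<close>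
  moreover have "q + (d y z / d y z) *\<^sub>R (r - q) = r" using tr by (cases "d y z = 0") auto
  moreover have "(g2 (d y z), q + (d y z / d y z) *\<^sub>R (r - q)) \<in> side_pts d g2 y z q r"
    unfolding side_pts_def by (auto simp del: divide_self_if)
  ultimately have v: "(z, r) \<in> side_pts d g2 y z q r" by simp
  have "\<forall>u\<in>side_pts d g x y p q \<union> side_pts d g2 y z q r \<union> side_pts d g3 z x r p.
      \<forall>v\<in>side_pts d g x y p q \<union> side_pts d g2 y z q r \<union> side_pts d g3 z x r p.
      d (fst u) (fst v) \<le> dist (snd u) (snd v)"
    using CAT0 assms g2 g3 tr unfolding CAT0_def Let_def by blast
  then have "d (fst (z, r)) (fst (g s, p + (s / d x y) *\<^sub>R (q - p)))
      \<le> dist (snd (z, r)) (snd (g s, p + (s / d x y) *\<^sub>R (q - p)))"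
    using u v by blast
  then have le: "d z (g s) \<le> dist r (p + (s / d x y) *\<^sub>R (q - p))" by simp
  have "(s / d x y) *\<^sub>R (q - p) = l *\<^sub>R (q - p)"
    using tr by (cases "d x y = 0") (auto simp: s_def)
  then have "(d z (g s))\<^sup>2 \<le> (dist r (p + l *\<^sub>R (q - p)))\<^sup>2"
    using le by (intro power_mono) auto
  then show ?thesis
    unfolding dist_segment_point_squared s_def using tr commute by (simp add: dist_commute)
qed

text \<open>Geodesics are unique: with \<open>m\<close> as the opposite vertex, the comparison
  inequality bounds the distance from \<open>m\<close> to the corresponding point of a geodesic by
  0.\<close>

lemma comparison:
  assumes "x \<in> X" "y \<in> X" "z \<in> X" "m \<in> X" "0 \<le> l" "l \<le> 1"
    and "d x m = l * d x y" "d m y = (1 - l) * d x y"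
  shows "(d z m)\<^sup>2 \<le> (1 - l) * (d z x)\<^sup>2 + l * (d z y)\<^sup>2 - l * (1 - l) * (d x y)\<^sup>2"
proof -
  obtain g where g: "geod_seg X d g x y" using geodesic_exists assms by blast
  have "l * d x y \<in> {0..d x y}" using assms by (auto intro: mult_left_le_one_le)
  then have gX: "g (l * d x y) \<in> X" using g unfolding geod_seg_def by blast
  have "(d m (g (l * d x y)))\<^sup>2 \<le> (1 - l) * (d m x)\<^sup>2 + l * (d m y)\<^sup>2 - l * (1 - l) * (d x y)\<^sup>2"
    using comparison_geodesic assms g by blast
  also have "\<dots> = 0"
    unfolding commute[of m x] assms(7,8) by (simp add: power2_eq_square algebra_simps)
  finally have "m = g (l * d x y)" using gX assms zero by auto
  then show ?thesis using comparison_geodesic assms g by blast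
qed

lemma midpoint_comparison:
  assumes "x \<in> X" "y \<in> X" "z \<in> X" "m \<in> X" "d x m = d x y / 2" "d m y = d x y / 2"
  shows "(d z m)\<^sup>2 \<le> (d z x)\<^sup>2 / 2 + (d z y)\<^sup>2 / 2 - (d x y)\<^sup>2 / 4"
  using comparison[of x y z m "1/2"] assms by simp

text \<open>The midpoint of one diagonal is compared from the other two vertices; the second
  diagonal is at most the sum of the two resulting distances.\<close>

lemma quadrilateral:
  assumes "x \<in> X" "y \<in> X" "z \<in> X" "w \<in> X"
  shows "(d x z)\<^sup>2 + (d y w)\<^sup>2 \<le> (d x y)\<^sup>2 + (d y z)\<^sup>2 + (d z w)\<^sup>2 + (d w x)\<^sup>2"
proof -
  obtain m where m: "m \<in> X" "d x m = d x z / 2" "d m z = d x z / 2"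
    using point_between[of x z "1/2"] assms by auto
  have y: "(d y m)\<^sup>2 \<le> (d y x)\<^sup>2 / 2 + (d y z)\<^sup>2 / 2 - (d x z)\<^sup>2 / 4"
    using midpoint_comparison assms m by blast
  have w: "(d w m)\<^sup>2 \<le> (d w x)\<^sup>2 / 2 + (d w z)\<^sup>2 / 2 - (d x z)\<^sup>2 / 4"
    using midpoint_comparison assms m by blast
  have "(d y w)\<^sup>2 \<le> (d y m + d w m)\<^sup>2"
    using triangle[of y m w] assms m by (intro power_mono) (auto simp: commute)
  also have "\<dots> \<le> 2 * (d y m)\<^sup>2 + 2 * (d w m)\<^sup>2"
    using sum_squares_bound[of "d y m" "d w m"] by (simp add: power2_sum)
  finally show ?thesis using y w by (simp add: commute)
qed

end

section \<open>Parallel lines\<close>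

text \<open>Increments over consecutive equal steps do not decrease, so one positive increment would
  repeat and exceed the bound.\<close>

lemma bounded_midpoint_convex_constant:
  fixes f :: "real \<Rightarrow> real"
  assumes convex: "\<And>s t. 2 * f s \<le> f (s - t) + f (s + t)" and bounded: "\<And>s. f s \<le> K"
  shows "f x = f y"
proof -
  have "f y \<le> f x" for x y
  proof (rule ccontr)
    assume "\<not> f y \<le> f x"
    define t e where "t = y - x" and "e = f y - f x"
    have e: "e > 0" using \<open>\<not> f y \<le> f x\<close> by (simp add: e_def)
    have step: "e \<le> f (x + real (Suc n) * t) - f (x + real n * t)" for n
    proof (induction n)
      case (Suc n)
      have "2 * f (x + real (Suc n) * t) \<le> f (x + real n * t) + f (x + real (Suc (Suc n)) * t)"
        using convex[of "x + real (Suc n) * t" t] by (simp add: algebra_simps)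
      with Suc show ?case by linarith
    qed (simp add: t_def e_def)
    have "f x + real n * e \<le> f (x + real n * t)" for n
    proof (induction n)
      case (Suc n)
      then show ?case using step[of n] by (simp add: algebra_simps)
    qed simp
    then have "real n * e \<le> K - f x" for n using bounded by (smt (verit))
    moreover obtain n :: nat where "(K - f x) / e < real n" using reals_Archimedean2 by blast
    ultimately show False using e by (simp add: field_simps) (meson not_less)
  qed
  then show ?thesis by (simp add: order_antisym)
qed

text \<open>The Jensen equation with \<open>g 0 = 0\<close> gives additivity. Subtracting
  \<open>g 1 * v\<close> leaves an additive function vanishing on the integers, hence periodic and
  bounded, hence 0.\<close>

lemma jensen_locally_bounded_linear:
  fixes g :: "real \<Rightarrow> real"
  assumes jensen: "\<And>v t. g (v + t) + g (v - t) = 2 * g v" and g0: "g 0 = 0"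
    and bounded: "\<And>v. 0 \<le> v \<Longrightarrow> v \<le> 1 \<Longrightarrow> \<bar>g v\<bar> \<le> K"
  shows "g v = g 1 * v"
proof -
  have additive: "g (x + y) = g x + g y" for x y
  proof -
    have "(x + y) / 2 + (x - y) / 2 = x" "(x + y) / 2 - (x - y) / 2 = y" by (simp_all add: field_simps)
    then show ?thesis
      using jensen[of "(x + y) / 2" "(x - y) / 2"] jensen[of "(x + y) / 2" "(x + y) / 2"] g0 by simp
  qed
  define f where "f v = g v - g 1 * v" for v
  have f: "f (x + y) = f x + f y" for x y by (simp add: f_def additive algebra_simps)
  have f_nat: "f (real n * x) = real n * f x" for n x
    by (induction n) (simp_all add: f algebra_simps, simp add: f_def g0)
  have "f 1 = 0" by (simp add: f_def)
  then have "f (real n) = 0" for n using f_nat[of n 1] by simp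
  moreover have "f (- x) = - f x" for x using f[of x "- x"] by (simp add: f_def g0)
  ultimately have f_int: "f (of_int i) = 0" for i by (cases i) (simp_all del: of_nat_Suc)
  have f_bounded: "\<bar>f x\<bar> \<le> K + \<bar>g 1\<bar>" for x
  proof -
    have "f x = f (frac x)" using f[of "of_int \<lfloor>x\<rfloor>" "frac x"] f_int by (simp add: frac_def)
    moreover have "\<bar>g (frac x)\<bar> \<le> K" using bounded[of "frac x"] frac_lt_1[of x] by simp
    moreover have "\<bar>g 1 * frac x\<bar> \<le> \<bar>g 1\<bar>"
      using frac_lt_1[of x] frac_ge_0[of x] by (simp add: abs_mult mult_left_le)
    ultimately show ?thesis unfolding f_def by linarith
  qed
  have "f v = 0"
  proof (rule ccontr)
    assume v: "f v \<noteq> 0"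
    obtain n :: nat where "(K + \<bar>g 1\<bar>) / \<bar>f v\<bar> < real n" using reals_Archimedean2 by blast
    then have "K + \<bar>g 1\<bar> < \<bar>f (real n * v)\<bar>" using v unfolding f_nat by (simp add: abs_mult field_simps)
    then show False using f_bounded[of "real n * v"] by simp
  qed
  then show ?thesis by (simp add: f_def)
qed

context cat0
begin

lemma complete_geodesic_mem: "complete_geodesic X d l \<Longrightarrow> l t \<in> X"
  by (simp add: complete_geodesic_def)

lemma complete_geodesic_dist: "complete_geodesic X d l \<Longrightarrow> d (l s) (l t) = \<bar>s - t\<bar>"
  by (simp add: complete_geodesic_def)

lemmas complete_geodesicD = complete_geodesic_mem complete_geodesic_dist

lemma line_comparison:
  assumes "complete_geodesic X d m" "z \<in> X"
  shows "(d z (m u))\<^sup>2 \<le> (d z (m (u - t)))\<^sup>2 / 2 + (d z (m (u + t)))\<^sup>2 / 2 - t\<^sup>2"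
  using midpoint_comparison[of "m (u - t)" "m (u + t)" z "m u"] assms
  by (simp add: complete_geodesicD power_mult_distrib abs_mult[of 2 t, simplified, symmetric] power2_eq_square)

text \<open>For fixed \<open>v\<close> the squared distance is a bounded midpoint convex function of
  \<open>s\<close>.\<close>

lemma parallel_lines_translation:
  assumes l: "complete_geodesic X d l" and m: "complete_geodesic X d m"
    and bounded: "\<And>s. d (l s) (m s) \<le> B"
  shows "d (l s) (m (s + v)) = d (l t) (m (t + v))"
proof -
  define H where "H s = (d (l s) (m (s + v)))\<^sup>2" for s
  have "2 * H s \<le> H (s - t) + H (s + t)" for s t
  proof -
    have "(d (m (s + v)) (l s))\<^sup>2 \<le>
        (d (m (s + v)) (l (s - t)))\<^sup>2 / 2 + (d (m (s + v)) (l (s + t)))\<^sup>2 / 2 - t\<^sup>2"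
      using line_comparison[of l "m (s + v)" s t] l m complete_geodesicD by blast
    moreover have "(d (l x) (m (s + v)))\<^sup>2 \<le>
        (d (l x) (m (s + v - t)))\<^sup>2 / 2 + (d (l x) (m (s + v + t)))\<^sup>2 / 2 - t\<^sup>2" for x
      using line_comparison[of m "l x" "s + v" t] l m complete_geodesicD by blast
    from this[of "s - t"] this[of "s + t"]
    have "(d (l (s - t)) (m (s + v)))\<^sup>2 + (d (l (s + t)) (m (s + v)))\<^sup>2 \<le>
        (d (l (s - t)) (m (s + v - t)))\<^sup>2 / 2 + (d (l (s - t)) (m (s + v + t)))\<^sup>2 / 2
        + (d (l (s + t)) (m (s + v - t)))\<^sup>2 / 2 + (d (l (s + t)) (m (s + v + t)))\<^sup>2 / 2 - 2 * t\<^sup>2"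
      by linarith
    \<comment> \<open>The mixed terms of the previous estimate are the diagonals of this
      quadrilateral; two of its squared sides are \<open>H (s - t)\<close> and
      \<open>H (s + t)\<close>.\<close>
    moreover have "(d (l (s - t)) (m (s + v + t)))\<^sup>2 + (d (l (s + t)) (m (s + v - t)))\<^sup>2 \<le>
        (2 * t)\<^sup>2 + (d (l (s + t)) (m (s + v + t)))\<^sup>2 + (2 * t)\<^sup>2 + (d (l (s - t)) (m (s + v - t)))\<^sup>2"
      using quadrilateral[of "l (s - t)" "l (s + t)" "m (s + v + t)" "m (s + v - t)"] l m
      by (simp add: complete_geodesicD commute[of "m (s + v - t)" "l (s - t)"])
    ultimately show ?thesis
      by (simp add: H_def commute[of "m (s + v)"] power_mult_distrib algebra_simps)
  qed
  moreover have "H s \<le> (B + \<bar>v\<bar>)\<^sup>2" for s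
  proof -
    have "d (l s) (m (s + v)) \<le> d (l s) (m s) + d (m s) (m (s + v))"
      using triangle l m complete_geodesicD by blast
    also have "\<dots> \<le> B + \<bar>v\<bar>" using bounded m by (intro add_mono) (auto simp: complete_geodesicD)
    finally show ?thesis unfolding H_def by (intro power_mono) auto
  qed
  ultimately have "H s = H t" by (rule bounded_midpoint_convex_constant)
  then show ?thesis by (simp add: H_def)
qed

text \<open>The flat strip theorem in coordinates: the law of cosines follows because the
  parallelogram inequality reverses the midpoint comparison inequality.\<close>
lemma parallel_lines_dist:
  assumes l: "complete_geodesic X d l" and m: "complete_geodesic X d m"
    and bounded: "\<And>s. d (l s) (m s) \<le> B"
  obtains b A where "0 \<le> A" "\<And>s u. (d (l s) (m u))\<^sup>2 = (u - s - b)\<^sup>2 + A\<^sup>2"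
proof -
  define F where "F v = (d (l 0) (m v))\<^sup>2" for v
  have F: "(d (l s) (m u))\<^sup>2 = F (u - s)" for s u
    using parallel_lines_translation[OF assms, of s "u - s" 0] by (simp add: F_def)
  have F_eq: "F (v + t) + F (v - t) = 2 * F v + 2 * t\<^sup>2" for v t
  proof -
    have "F v \<le> F (v - t) / 2 + F (v + t) / 2 - t\<^sup>2"
      using line_comparison[of m "l 0" v t] l m by (simp add: F_def complete_geodesicD)
    moreover have "(d (l 0) (m (v + t)))\<^sup>2 + (d (l t) (m v))\<^sup>2 \<le>
        (d (l 0) (l t))\<^sup>2 + (d (l t) (m (v + t)))\<^sup>2 + (d (m (v + t)) (m v))\<^sup>2 + (d (m v) (l 0))\<^sup>2"
      using quadrilateral l m complete_geodesicD by blast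
    ultimately show ?thesis using l m by (simp add: F complete_geodesicD commute[of "m v" "l 0"])
  qed
  \<comment> \<open>Removing \<open>v\<^sup>2\<close> turns \<open>F_eq\<close> into the Jensen
    equation, so \<open>F\<close> is a quadratic polynomial with leading coefficient 1;
    \<open>b\<close> below is where it is minimal.\<close>
  define g where "g v = F v - v\<^sup>2 - F 0" for v
  have g: "g v = g 1 * v" for v
  proof (rule jensen_locally_bounded_linear)
    show "g (v + t) + g (v - t) = 2 * g v" for v t
      using F_eq[of v t] by (simp add: g_def power2_eq_square algebra_simps)
    show "g 0 = 0" by (simp add: g_def)
    show "\<bar>g v\<bar> \<le> (B + 1)\<^sup>2 + 1 + F 0" if "0 \<le> v" "v \<le> 1" for v
    proof -
      have "d (l 0) (m v) \<le> d (l 0) (m 0) + d (m 0) (m v)"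
        using triangle l m complete_geodesicD by blast
      also have "\<dots> \<le> B + 1" using bounded m that by (intro add_mono) (auto simp: complete_geodesicD)
      finally have "F v \<le> (B + 1)\<^sup>2" unfolding F_def by (intro power_mono) auto
      moreover have "0 \<le> F v" "0 \<le> F 0" by (auto simp: F_def)
      moreover have "v\<^sup>2 \<le> 1" "0 \<le> v\<^sup>2" using that by (auto simp: power_le_one)
      moreover have "0 \<le> (B + 1)\<^sup>2" by simp
      ultimately show ?thesis unfolding g_def abs_le_iff by linarith
    qed
  qed
  define b where "b = - g 1 / 2"
  have Fb: "F v = (v - b)\<^sup>2 + F b" for v
    using g[of v] g[of b] by (simp add: b_def g_def power2_eq_square field_simps)
  show ?thesis
  proof (rule that[of "sqrt (F b)" b])
    show "(d (l s) (m u))\<^sup>2 = (u - s - b)\<^sup>2 + (sqrt (F b))\<^sup>2" for s u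
      using F Fb[of "u - s"] by (simp add: F_def)
  qed (simp add: F_def)
qed

text \<open>On the way from \<open>l1 0\<close> via \<open>l2 T\<close> to \<open>l3 (2 * T)\<close>
  the legs have lengths \<open>T - b12\<close> and \<open>T - b23\<close> up to terms vanishing as
  \<open>T\<close> grows, while the total distance is at least \<open>2 * T - b13\<close>.\<close>

lemma offset_superadditive:
  assumes l: "complete_geodesic X d l1" "complete_geodesic X d l2" "complete_geodesic X d l3"
    and 12: "\<And>s u. (d (l1 s) (l2 u))\<^sup>2 = (u - s - b12)\<^sup>2 + A12\<^sup>2"
    and 23: "\<And>s u. (d (l2 s) (l3 u))\<^sup>2 = (u - s - b23)\<^sup>2 + A23\<^sup>2"
    and 13: "\<And>s u. (d (l1 s) (l3 u))\<^sup>2 = (u - s - b13)\<^sup>2 + A13\<^sup>2"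
  shows "b12 + b23 \<le> b13"
proof -
  have "((\<lambda>T. (sqrt ((T - b12)\<^sup>2 + A12\<^sup>2) - T) + (sqrt ((T - b23)\<^sup>2 + A23\<^sup>2) - T))
      \<longlongrightarrow> - b12 + - b23) at_top"
    by (intro tendsto_add; real_asymp)
  moreover have "- b13 \<le> (sqrt ((T - b12)\<^sup>2 + A12\<^sup>2) - T) + (sqrt ((T - b23)\<^sup>2 + A23\<^sup>2) - T)" for T
  proof -
    have "2 * T - b13 \<le> sqrt ((2 * T - b13)\<^sup>2 + A13\<^sup>2)" by (rule real_le_rsqrt) simp
    also have "\<dots> = d (l1 0) (l3 (2 * T))" using 13[of 0 "2 * T"] by (intro real_sqrt_unique) auto
    also have "\<dots> \<le> d (l1 0) (l2 T) + d (l2 T) (l3 (2 * T))" using triangle l complete_geodesicD by blast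
    also have "d (l1 0) (l2 T) = sqrt ((T - b12)\<^sup>2 + A12\<^sup>2)"
      using 12[of 0 T] by (intro real_sqrt_unique[symmetric]) auto
    also have "d (l2 T) (l3 (2 * T)) = sqrt ((T - b23)\<^sup>2 + A23\<^sup>2)"
      using 23[of T "2 * T"] by (intro real_sqrt_unique[symmetric]) auto
    finally show ?thesis by simp
  qed
  ultimately have "- b13 \<le> - b12 + - b23"
    by (intro tendsto_lowerbound[OF _ always_eventually]) auto
  then show ?thesis by simp
qed

text \<open>Reversing the three lines negates all offsets, which gives the opposite
  inequality.\<close>

lemma offset_additive:
  assumes l: "complete_geodesic X d l1" "complete_geodesic X d l2" "complete_geodesic X d l3"
    and 12: "\<And>s u. (d (l1 s) (l2 u))\<^sup>2 = (u - s - b12)\<^sup>2 + A12\<^sup>2"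
    and 23: "\<And>s u. (d (l2 s) (l3 u))\<^sup>2 = (u - s - b23)\<^sup>2 + A23\<^sup>2"
    and 13: "\<And>s u. (d (l1 s) (l3 u))\<^sup>2 = (u - s - b13)\<^sup>2 + A13\<^sup>2"
  shows "b12 + b23 = b13"
proof (rule antisym)
  show "b12 + b23 \<le> b13" using offset_superadditive assms by blast
  have neg: "(- u - - s - b)\<^sup>2 = (u - s - - b)\<^sup>2" for u s b :: real
    by (simp add: power2_eq_square algebra_simps)
  have "- b12 + - b23 \<le> - b13"
  proof (rule offset_superadditive)
    show "complete_geodesic X d (\<lambda>t. l1 (- t))" "complete_geodesic X d (\<lambda>t. l2 (- t))"
      "complete_geodesic X d (\<lambda>t. l3 (- t))"
      using l by (auto simp: complete_geodesic_def)
    show "(d (l1 (- s)) (l2 (- u)))\<^sup>2 = (u - s - - b12)\<^sup>2 + A12\<^sup>2" for s u using 12 neg by simp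
    show "(d (l2 (- s)) (l3 (- u)))\<^sup>2 = (u - s - - b23)\<^sup>2 + A23\<^sup>2" for s u using 23 neg by simp
    show "(d (l1 (- s)) (l3 (- u)))\<^sup>2 = (u - s - - b13)\<^sup>2 + A13\<^sup>2" for s u using 13 neg by simp
  qed
  then show "b13 \<le> b12 + b23" by simp
qed

text \<open>\<open>r s\<close> divides the segment from \<open>l s\<close> to \<open>m s\<close>,
  and comparison shows that \<open>r\<close> is 1-Lipschitz. It cannot shorten distances, because
  passing from \<open>l (- T)\<close> to \<open>l T\<close> through \<open>r s\<close> and
  \<open>r u\<close> would then beat the geodesic \<open>l\<close> for large
  \<open>T\<close>.\<close>

lemma intermediate_line:
  assumes l: "complete_geodesic X d l" and m: "complete_geodesic X d m"
    and lm: "\<And>s u. (d (l s) (m u))\<^sup>2 = (u - s)\<^sup>2 + A\<^sup>2" and A: "0 \<le> A" and k: "0 \<le> k" "k \<le> 1"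
  obtains r where "complete_geodesic X d r" "\<And>s. d (l s) (r s) = k * A"
    "\<And>s. d (r s) (m s) = (1 - k) * A" "\<And>s u. (d (l s) (r u))\<^sup>2 \<le> (u - s)\<^sup>2 + (k * A)\<^sup>2"
proof -
  have lm0: "d (l s) (m s) = A" for s using lm[of s s] A by (simp add: power2_eq_iff_nonneg)
  have "\<forall>s. \<exists>x. x \<in> X \<and> d (l s) x = k * A \<and> d x (m s) = (1 - k) * A"
  proof
    fix s
    obtain x where "x \<in> X" "d (l s) x = k * d (l s) (m s)" "d x (m s) = (1 - k) * d (l s) (m s)"
      using point_between complete_geodesic_mem l m k by metis
    then show "\<exists>x. x \<in> X \<and> d (l s) x = k * A \<and> d x (m s) = (1 - k) * A" using lm0 by auto
  qed
  then obtain r where r: "r s \<in> X" "d (l s) (r s) = k * A" "d (r s) (m s) = (1 - k) * A" for s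
    by metis
  have cmp: "(d z (r u))\<^sup>2 \<le> (1 - k) * (d z (l u))\<^sup>2 + k * (d z (m u))\<^sup>2 - k * (1 - k) * A\<^sup>2"
    if "z \<in> X" for z u
    using comparison[of "l u" "m u" z "r u" k] that l m r k by (simp add: complete_geodesicD lm0)
  have lr: "(d (l s) (r u))\<^sup>2 \<le> (u - s)\<^sup>2 + (k * A)\<^sup>2" for s u
  proof -
    have "(d (l s) (r u))\<^sup>2 \<le> (1 - k) * \<bar>s - u\<bar>\<^sup>2 + k * ((u - s)\<^sup>2 + A\<^sup>2) - k * (1 - k) * A\<^sup>2"
      using cmp[of "l s" u] l lm by (simp add: complete_geodesicD)
    also have "\<dots> = (u - s)\<^sup>2 + (k * A)\<^sup>2" by (simp add: power2_eq_square algebra_simps)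
    finally show ?thesis .
  qed
  have mr: "(d (m s) (r u))\<^sup>2 \<le> (u - s)\<^sup>2 + ((1 - k) * A)\<^sup>2" for s u
  proof -
    have "(d (m s) (r u))\<^sup>2 \<le> (1 - k) * ((s - u)\<^sup>2 + A\<^sup>2) + k * \<bar>s - u\<bar>\<^sup>2 - k * (1 - k) * A\<^sup>2"
      using cmp[of "m s" u] m lm[of u s] commute[of "m s" "l u"] by (simp add: complete_geodesicD)
    also have "\<dots> = (u - s)\<^sup>2 + ((1 - k) * A)\<^sup>2" by (simp add: power2_eq_square algebra_simps)
    finally show ?thesis .
  qed
  have upper: "d (r s) (r u) \<le> \<bar>s - u\<bar>" for s u
  proof -
    have "(d (r s) (r u))\<^sup>2 \<le> (1 - k) * (d (r s) (l u))\<^sup>2 + k * (d (r s) (m u))\<^sup>2 - k * (1 - k) * A\<^sup>2"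
      using cmp r by blast
    also have "\<dots> \<le> (1 - k) * ((s - u)\<^sup>2 + (k * A)\<^sup>2) + k * ((s - u)\<^sup>2 + ((1 - k) * A)\<^sup>2)
        - k * (1 - k) * A\<^sup>2"
      using lr[of u s] mr[of u s] k commute by (intro diff_mono add_mono mult_left_mono) auto
    also have "\<dots> = \<bar>s - u\<bar>\<^sup>2" by (simp add: power2_eq_square algebra_simps)
    finally show ?thesis by (simp add: abs_le_square_iff[symmetric])
  qed
  have lower: "u - s \<le> d (r s) (r u)" for s u
  proof -
    have "((\<lambda>T. d (r s) (r u) + (sqrt ((s + T)\<^sup>2 + (k * A)\<^sup>2) - T) + (sqrt ((u - T)\<^sup>2 + (k * A)\<^sup>2) - T))
        \<longlongrightarrow> d (r s) (r u) + s + - u) at_top"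
      by (intro tendsto_add tendsto_const; real_asymp)
    moreover have "0 \<le> d (r s) (r u) + (sqrt ((s + T)\<^sup>2 + (k * A)\<^sup>2) - T)
        + (sqrt ((u - T)\<^sup>2 + (k * A)\<^sup>2) - T)" for T
    proof -
      have "2 * T \<le> d (l (- T)) (l T)" using l by (simp add: complete_geodesicD)
      also have "\<dots> \<le> d (l (- T)) (r s) + (d (r s) (r u) + d (r u) (l T))"
        using triangle[of "l (- T)" "r s" "l T"] triangle[of "r s" "r u" "l T"] l r
        by (simp add: complete_geodesicD)
      also have "d (l (- T)) (r s) \<le> sqrt ((s + T)\<^sup>2 + (k * A)\<^sup>2)"
        using lr[of "- T" s] by (intro real_le_rsqrt) simp
      also have "d (r u) (l T) \<le> sqrt ((u - T)\<^sup>2 + (k * A)\<^sup>2)"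
        using lr[of T u] commute by (intro real_le_rsqrt) simp
      finally show ?thesis by simp
    qed
    ultimately have "0 \<le> d (r s) (r u) + s + - u"
      by (intro tendsto_lowerbound[OF _ always_eventually]) auto
    then show ?thesis by simp
  qed
  have "complete_geodesic X d r"
    unfolding complete_geodesic_def
  proof (intro conjI allI)
    show "d (r s) (r t) = \<bar>s - t\<bar>" for s t
      using upper[of s t] lower[of s t] lower[of t s] commute[of "r s" "r t"] by linarith
  qed (use r in auto)
  then show ?thesis using that r lr by blast
qed

end

section \<open>Two product structures on the same set\<close>

text \<open>Models a product of a line with a geodesic space: \<open>h\<close> is the coordinate on
  the line, \<open>a\<close> the distance of the other factor pulled back to \<open>P\<close>, and
  \<open>\<tau>\<close> the translation along the line. The product metric has the square
  \<open>(h p - h q)\<^sup>2 + (a p q)\<^sup>2\<close>.\<close>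

locale line_product =
  fixes P :: "'a set" and \<tau> :: "real \<Rightarrow> 'a \<Rightarrow> 'a" and h :: "'a \<Rightarrow> real" and a :: "'a \<Rightarrow> 'a \<Rightarrow> real"
  assumes tau_mem: "p \<in> P \<Longrightarrow> \<tau> s p \<in> P"
    and h_tau: "p \<in> P \<Longrightarrow> h (\<tau> s p) = h p + s"
    and a_tau: "p \<in> P \<Longrightarrow> q \<in> P \<Longrightarrow> a (\<tau> s p) q = a p q"
    and a_sym: "a p q = a q p"
    and a_nonneg: "p \<in> P \<Longrightarrow> q \<in> P \<Longrightarrow> 0 \<le> a p q"
    and a_self: "p \<in> P \<Longrightarrow> a p p = 0"
    and a_zero: "p \<in> P \<Longrightarrow> q \<in> P \<Longrightarrow> h p = h q \<Longrightarrow> a p q = 0 \<Longrightarrow> p = q"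
    and a_triangle: "p \<in> P \<Longrightarrow> q \<in> P \<Longrightarrow> r \<in> P \<Longrightarrow> a p q \<le> a p r + a r q"
    and between: "p \<in> P \<Longrightarrow> q \<in> P \<Longrightarrow> h p = h q \<Longrightarrow> 0 \<le> l \<Longrightarrow> l \<le> 1 \<Longrightarrow>
      \<exists>r\<in>P. h r = h p \<and> a p r = l * a p q \<and> a r q = (1 - l) * a p q"
begin

lemma a_tau_right: "p \<in> P \<Longrightarrow> q \<in> P \<Longrightarrow> a p (\<tau> s q) = a p q"
  using a_tau a_sym by metis

lemma tau_zero:
  assumes "p \<in> P"
  shows "\<tau> 0 p = p"
proof (rule a_zero)
  show "h (\<tau> 0 p) = h p" using h_tau[OF assms, of 0] by simp
  show "a (\<tau> 0 p) p = 0" using a_tau[OF assms assms, of 0] a_self[OF assms] by simp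
qed (use assms tau_mem in auto)

lemma split:
  assumes "p \<in> P" "q \<in> P" "h p = h q" "a p q \<le> A + B" "0 \<le> A" "0 \<le> B"
  obtains r where "r \<in> P" "h r = h p" "a p r \<le> A" "a r q \<le> B"
proof (cases "a p q \<le> B")
  case True
  then show ?thesis using assms that[of p] a_self by auto
next
  case False
  then have pos: "a p q > 0" using assms by simp
  define l where "l = 1 - B / a p q"
  have l: "0 \<le> l" "l \<le> 1" using False pos assms by (auto simp: l_def field_simps)
  obtain r where r: "r \<in> P" "h r = h p" "a p r = l * a p q" "a r q = (1 - l) * a p q"
    using between assms l by blast
  have "l * a p q = a p q - B" "(1 - l) * a p q = B"
    using pos by (auto simp: l_def field_simps)
  then show ?thesis using r assms that[of r] by auto
qed

definition align :: "real \<Rightarrow> 'a \<Rightarrow> 'a" where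
  "align x p = \<tau> (x - h p) p"

lemma align:
  assumes "p \<in> P"
  shows "align x p \<in> P" "h (align x p) = x"
    "q \<in> P \<Longrightarrow> a (align x p) q = a p q" "q \<in> P \<Longrightarrow> a q (align x p) = a q p"
  using assms tau_mem h_tau a_tau a_tau_right by (auto simp: align_def)

end

text \<open>Points at heights differing by \<open>e\<close> are at distance at most 1 up to a unit vertical shift
  iff their transversal distance is at most \<open>chord e\<close>.\<close>
definition chord :: "real \<Rightarrow> real" where
  "chord e = sqrt (2 * e - e\<^sup>2)"

lemma chord_pos: "0 < e \<Longrightarrow> e < 1 \<Longrightarrow> 0 < chord e"
proof -
  assume "0 < e" "e < 1"
  then have "0 < e * (2 - e)" by simp
  then show ?thesis by (simp add: chord_def power2_eq_square algebra_simps)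
qed

lemma chord_squared: "0 \<le> e \<Longrightarrow> e \<le> 1 \<Longrightarrow> (chord e)\<^sup>2 = 2 * e - e\<^sup>2"
proof -
  assume "0 \<le> e" "e \<le> 1"
  then have "0 \<le> e * (2 - e)" by simp
  then show ?thesis by (simp add: chord_def power2_eq_square algebra_simps)
qed

lemma le_chord_squared: "0 \<le> e \<Longrightarrow> e \<le> 1 \<Longrightarrow> e \<le> (chord e)\<^sup>2"
  using mult_left_le[of e e] chord_squared[of e] by (simp add: power2_eq_square)

text \<open>Converts a quotient of chords into a quotient of height differences; the correcting
  factor tends to 1 as \<open>e\<close> and \<open>f\<close> tend to 0.\<close>

lemma chord_quotient:
  assumes "0 < e" "e < 1" "0 < f" "f < 1"
  shows "(chord f / chord e)\<^sup>2 * ((2 - e) / (2 - f)) = f / e"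
proof -
  have "(chord e)\<^sup>2 = e * (2 - e)" "(chord f)\<^sup>2 = f * (2 - f)"
    using assms chord_squared[of e] chord_squared[of f] by (auto simp: power2_eq_square algebra_simps)
  then show ?thesis using assms by (simp add: power_divide)
qed

lemma chord_tendsto_zero:
  assumes "(f \<longlongrightarrow> 0) F"
  shows "((\<lambda>x. chord (f x)) \<longlongrightarrow> 0) F"
proof -
  have "((\<lambda>x. chord (f x)) \<longlongrightarrow> sqrt (2 * 0 - 0\<^sup>2)) F"
    unfolding chord_def by (intro tendsto_intros assms)
  then show ?thesis by simp
qed

lemma le_chord_iff:
  assumes "0 \<le> b" "0 < e" "e < 1"
  shows "b \<le> chord e \<longleftrightarrow> (1 - e)\<^sup>2 + b\<^sup>2 \<le> 1"
proof -
  have "b \<le> chord e \<longleftrightarrow> b\<^sup>2 \<le> (chord e)\<^sup>2"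
    using assms chord_pos[of e] abs_le_square_iff[of b "chord e"] by simp
  moreover have "(1 - e)\<^sup>2 = 1 - (2 * e - e\<^sup>2)" by (simp add: power2_diff)
  ultimately show ?thesis using assms chord_squared[of e] by auto
qed

locale two_line_products = line_product P \<tau> h a + L': line_product P \<tau>' h' a'
  for P :: "'a set" and \<tau> h a \<tau>' h' a' +
  assumes tau_one: "p \<in> P \<Longrightarrow> \<tau> 1 p = \<tau>' 1 p"
    and balls: "p \<in> P \<Longrightarrow> q \<in> P \<Longrightarrow>
      (h p - h q)\<^sup>2 + (a p q)\<^sup>2 \<le> (real n)\<^sup>2 \<longleftrightarrow> (h' p - h' q)\<^sup>2 + (a' p q)\<^sup>2 \<le> (real n)\<^sup>2"
begin

lemma swap: "two_line_products P \<tau>' h' a' \<tau> h a"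
  using tau_one balls
  by (intro two_line_products.intro L'.line_product_axioms line_product_axioms
      two_line_products_axioms.intro) auto

lemma unit_shifts:
  assumes "p \<in> P"
  shows "\<exists>r\<in>P. h r = h p + real k \<and> h' r = h' p + real k \<and> (\<forall>q\<in>P. a r q = a p q \<and> a' r q = a' p q)"
proof (induction k)
  case 0
  then show ?case using assms by (intro bexI[of _ p]) auto
next
  case (Suc k)
  then obtain r where r: "r \<in> P" "h r = h p + real k" "h' r = h' p + real k"
    "\<forall>q\<in>P. a r q = a p q \<and> a' r q = a' p q" by blast
  have "h' (\<tau> 1 r) = h' r + 1" using tau_one[of r] L'.h_tau r by simp
  moreover have "a' (\<tau> 1 r) q = a' r q" if "q \<in> P" for q
    using tau_one[of r] L'.a_tau r that by simp
  ultimately show ?case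
    using r tau_mem h_tau a_tau by (intro bexI[of _ "\<tau> 1 r"]) auto
qed

lemma balls_shifted:
  assumes "p \<in> P" "q \<in> P"
  shows "(h p + real k - h q)\<^sup>2 + (a p q)\<^sup>2 \<le> (real n)\<^sup>2 \<longleftrightarrow>
    (h' p + real k - h' q)\<^sup>2 + (a' p q)\<^sup>2 \<le> (real n)\<^sup>2"
proof -
  obtain r where "r \<in> P" "h r = h p + real k" "h' r = h' p + real k"
    "\<forall>q\<in>P. a r q = a p q \<and> a' r q = a' p q" using unit_shifts assms by metis
  then show ?thesis using balls[of r q n] assms by simp
qed

text \<open>For large \<open>n\<close> the ball of radius \<open>n\<close> about the point
  \<open>n\<close> above \<open>p\<close> contains \<open>q\<close>. Conversely, such a ball lies
  strictly above \<open>p\<close>, apart from \<open>p\<close> itself.\<close>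

lemma height_mono:
  assumes "p \<in> P" "q \<in> P" "h p < h q"
  shows "h' p < h' q"
proof -
  define s where "s = h q - h p"
  have s: "s > 0" using assms by (simp add: s_def)
  obtain n :: nat where n: "(s\<^sup>2 + (a p q)\<^sup>2) / (2 * s) < real n"
    using reals_Archimedean2 by blast
  then have "s\<^sup>2 + (a p q)\<^sup>2 \<le> 2 * real n * s" using s by (simp add: field_simps)
  then have "(h p + real n - h q)\<^sup>2 + (a p q)\<^sup>2 \<le> (real n)\<^sup>2"
    by (simp add: s_def power2_eq_square algebra_simps)
  then have "(h' p + real n - h' q)\<^sup>2 + (a' p q)\<^sup>2 \<le> (real n)\<^sup>2"
    using balls_shifted assms by blast
  then have *: "(h' q - h' p)\<^sup>2 + (a' p q)\<^sup>2 \<le> 2 * real n * (h' q - h' p)"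
    by (simp add: power2_eq_square algebra_simps)
  have "0 < (s\<^sup>2 + (a p q)\<^sup>2) / (2 * s)" using s by (simp add: add_pos_nonneg)
  then have n0: "real n > 0" using n by linarith
  have "0 \<le> 2 * real n * (h' q - h' p)"
    using * sum_power2_ge_zero[of "h' q - h' p" "a' p q"] by linarith
  then have "0 \<le> h' q - h' p" using n0 by (simp add: zero_le_mult_iff)
  moreover have "h' q \<noteq> h' p"
  proof
    assume eq: "h' q = h' p"
    with * have "a' p q = 0" by simp
    then have "p = q" using L'.a_zero assms eq by auto
    then show False using assms by simp
  qed
  ultimately show ?thesis by simp
qed

lemma height_less_iff: "p \<in> P \<Longrightarrow> q \<in> P \<Longrightarrow> h' p < h' q \<longleftrightarrow> h p < h q"
  using height_mono two_line_products.height_mono[OF swap] by blast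

lemma height_eq_iff: "p \<in> P \<Longrightarrow> q \<in> P \<Longrightarrow> h' p = h' q \<longleftrightarrow> h p = h q"
  using height_less_iff by (metis linorder_less_linear less_irrefl)

lemma height_less_one:
  assumes "p \<in> P" "q \<in> P" "h q < h p + 1"
  shows "h' q < h' p + 1"
proof -
  obtain r where "r \<in> P" "h r = h p + 1" "h' r = h' p + 1" using unit_shifts[of p 1] assms by auto
  then show ?thesis using height_mono[of q r] assms by auto
qed

lemma height_close:
  assumes "p \<in> P" "q \<in> P" "0 < \<bar>h p - h q\<bar>" "\<bar>h p - h q\<bar> < 1"
  shows "0 < \<bar>h' p - h' q\<bar>" "\<bar>h' p - h' q\<bar> < 1"
  using assms height_less_one[of p q] height_less_one[of q p] height_eq_iff[of p q]
  by (auto simp: abs_less_iff)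

lemma close_iff_aux:
  assumes "p \<in> P" "q \<in> P" "0 < h q - h p" "h q - h p < 1"
  shows "a p q \<le> chord (h q - h p) \<longleftrightarrow> a' p q \<le> chord (h' q - h' p)"
proof -
  have *: "0 < h' q - h' p" "h' q - h' p < 1"
    using height_mono[of p q] height_less_one[of p q] assms by auto
  \<comment> \<open>Raising the lower point by one unit turns a height difference \<open>e\<close>
    into \<open>1 - e\<close> in both structures, so the unit ball can be used.\<close>
  have e: "h p + real 1 - h q = 1 - (h q - h p)" "h' p + real 1 - h' q = 1 - (h' q - h' p)" by auto
  show ?thesis
    using balls_shifted[of p q 1 1] assms
      le_chord_iff[of "a p q" "h q - h p"] le_chord_iff[of "a' p q" "h' q - h' p"] *
      a_nonneg[of p q] L'.a_nonneg[of p q] unfolding e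
    by simp
qed

lemma close_iff:
  assumes "p \<in> P" "q \<in> P" "0 < \<bar>h p - h q\<bar>" "\<bar>h p - h q\<bar> < 1"
  shows "a p q \<le> chord \<bar>h p - h q\<bar> \<longleftrightarrow> a' p q \<le> chord \<bar>h' p - h' q\<bar>"
proof (cases "h p < h q")
  case True
  then show ?thesis using close_iff_aux[of p q] height_mono[of p q] assms
    by (simp add: abs_if)
next
  case False
  then have "h q < h p" using assms by auto
  then show ?thesis using close_iff_aux[of q p] height_mono[of q p] assms
    by (simp add: abs_if a_sym[of p q] L'.a_sym[of p q])
qed

text \<open>A path in the transversal direction at the height of \<open>p\<close> is followed in zigzags between
  this height and the height of \<open>z\<close>, because only points at different heights can be compared.\<close>
lemma zigzag:
  assumes z: "z \<in> P" and "p \<in> P" "q \<in> P" "h p = h q"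
    and close: "0 < \<bar>h p - h z\<bar>" "\<bar>h p - h z\<bar> < 1"
    and "a p q \<le> 2 * real k * chord \<bar>h p - h z\<bar>"
  shows "a' p q \<le> 2 * real k * chord \<bar>h' p - h' z\<bar>"
  using assms(3,4,7)
proof (induction k arbitrary: q)
  case 0
  then have "a p q = 0" using a_nonneg[of p q] assms by simp
  then have "p = q" using a_zero 0 assms by simp
  then show ?case using L'.a_self assms by simp
next
  case (Suc k)
  define e where "e = chord \<bar>h p - h z\<bar>"
  define e' where "e' = chord \<bar>h' p - h' z\<bar>"
  have e: "e > 0" using chord_pos close by (simp add: e_def)
  \<comment> \<open>The last leg, of length at most \<open>e + e\<close>, is cut off at
    \<open>r\<close> and divided at \<open>m\<close>; \<open>n\<close> is \<open>m\<close> moved to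
    the height of \<open>z\<close>, where it can be compared with \<open>r\<close> and
    \<open>q\<close>.\<close>
  obtain r where r: "r \<in> P" "h r = h p" "a p r \<le> 2 * real k * e" "a r q \<le> e + e"
    using split[of p q "2 * real k * e" "e + e"] assms Suc.prems e
    by (auto simp: e_def algebra_simps)
  obtain m where m: "m \<in> P" "h m = h p" "a r m \<le> e" "a m q \<le> e"
    using split[of r q e e] r Suc.prems e by auto
  define n where "n = align (h z) m"
  have n: "n \<in> P" "h n = h z" "a r n \<le> e" "a n q \<le> e"
    using align[OF m(1)] m r Suc.prems by (auto simp: n_def)
  have h': "h' n = h' z" "h' r = h' p" "h' q = h' p"
    using height_eq_iff n r z assms Suc.prems by simp_all
  have "a' r n \<le> e'"
    using close_iff[of r n] r n close h' by (simp add: e_def e'_def)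
  moreover have "a' n q \<le> e'"
    using close_iff[of n q] Suc.prems n close h'
    by (simp add: e_def e'_def abs_minus_commute[of "h z"] abs_minus_commute[of "h' z"])
  moreover have "a' p r \<le> 2 * real k * e'"
    using Suc.IH[of r] r by (simp add: e_def e'_def)
  moreover have "a' p q \<le> a' p r + (a' r n + a' n q)"
    using L'.a_triangle[of p q r] L'.a_triangle[of r q n] assms Suc.prems r n by linarith
  ultimately have "a' p q \<le> 2 * real (Suc k) * e'" by (simp add: algebra_simps)
  then show ?case by (simp add: e'_def)
qed

lemma zigzag_iff:
  assumes "z \<in> P" "p \<in> P" "q \<in> P" "h p = h q" "0 < \<bar>h p - h z\<bar>" "\<bar>h p - h z\<bar> < 1"
  shows "a p q \<le> 2 * real k * chord \<bar>h p - h z\<bar> \<longleftrightarrow> a' p q \<le> 2 * real k * chord \<bar>h' p - h' z\<bar>"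
  using zigzag[of z p q k] two_line_products.zigzag[OF swap, of z p q k] assms
    height_close[of p z] height_eq_iff[of p q] by blast

text \<open>The number \<open>k\<close> of zigzags needed from \<open>p\<close> to \<open>q\<close>
  is the same in both structures, and it determines \<open>a p q\<close> up to \<open>2 * e\<close>
  and \<open>a' p q\<close> up to \<open>2 * e'\<close>.\<close>

lemma ratio_estimate:
  assumes "z \<in> P" "p \<in> P" "q \<in> P" "h p = h q" "0 < \<bar>h p - h z\<bar>" "\<bar>h p - h z\<bar> < 1"
  shows "\<bar>a p q * chord \<bar>h' p - h' z\<bar> - a' p q * chord \<bar>h p - h z\<bar>\<bar>
    \<le> 2 * chord \<bar>h p - h z\<bar> * chord \<bar>h' p - h' z\<bar>"
proof -
  define e where "e = chord \<bar>h p - h z\<bar>"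
  define e' where "e' = chord \<bar>h' p - h' z\<bar>"
  have e: "e > 0" "e' > 0"
    using chord_pos assms height_close[of p z] by (auto simp: e_def e'_def)
  have iff: "a p q \<le> 2 * real k * e \<longleftrightarrow> a' p q \<le> 2 * real k * e'" for k
    using zigzag_iff assms by (simp add: e_def e'_def)
  have nn: "0 \<le> a p q" "0 \<le> a' p q" using a_nonneg L'.a_nonneg assms by auto
  define k where "k = nat \<lceil>a p q / (2 * e)\<rceil>"
  have "a p q / (2 * e) \<le> real k" by (simp add: k_def) linarith
  then have up: "a p q \<le> 2 * real k * e" using e by (simp add: field_simps)
  then have up': "a' p q \<le> 2 * real k * e'" using iff by blast
  have low: "2 * (real k - 1) * e \<le> a p q \<and> 2 * (real k - 1) * e' \<le> a' p q"
  proof (cases k)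
    case 0
    then show ?thesis using nn e by auto
  next
    case (Suc j)
    have "real j < a p q / (2 * e)" using Suc nn e unfolding k_def by linarith
    then have "2 * real j * e < a p q" using e by (simp add: field_simps)
    moreover from this have "2 * real j * e' < a' p q" using iff[of j] by linarith
    ultimately show ?thesis using Suc by simp
  qed
  have "a p q * e' \<le> 2 * real k * e * e'" "a' p q * e \<le> 2 * real k * e' * e"
    using up up' e by (auto intro: mult_right_mono)
  moreover have "2 * (real k - 1) * e * e' \<le> a p q * e'" "2 * (real k - 1) * e' * e \<le> a' p q * e"
    using low e by (auto intro: mult_right_mono)
  ultimately have "\<bar>a p q * e' - a' p q * e\<bar> \<le> 2 * e * e'"
    by (simp add: abs_le_iff algebra_simps)
  then show ?thesis by (simp add: e_def e'_def)
qed

lemma chord_abs_tendsto: "((\<lambda>y. chord \<bar>x - y\<bar>) \<longlongrightarrow> 0) (at x)"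
proof (rule chord_tendsto_zero)
  have "((\<lambda>y. \<bar>x - y\<bar>) \<longlongrightarrow> \<bar>x - x\<bar>) (at x)" by (intro tendsto_intros)
  then show "((\<lambda>y. \<bar>x - y\<bar>) \<longlongrightarrow> 0) (at x)" by simp
qed

lemma eventually_near:
  "eventually (\<lambda>y. 0 < \<bar>x - y\<bar> \<and> \<bar>x - y\<bar> < 1) (at (x::real))"
  unfolding eventually_at by (intro exI[of _ 1]) (auto simp: dist_real_def abs_minus_commute)

section \<open>The scaling factor of a slice and the derivative of the height change\<close>

context
  fixes p q
  assumes p: "p \<in> P" and q: "q \<in> P" and pq: "h p = h q" and pos: "a p q > 0"
begin

lemma ratio_estimate_align:
  assumes "0 < \<bar>h p - y\<bar>" "\<bar>h p - y\<bar> < 1" "r \<in> P" "s \<in> P" "h r = h p" "h s = h p"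
  shows "\<bar>a r s * chord \<bar>h' p - h' (align y p)\<bar> - a' r s * chord \<bar>h p - y\<bar>\<bar>
    \<le> 2 * chord \<bar>h p - y\<bar> * chord \<bar>h' p - h' (align y p)\<bar>"
proof -
  have "h' r = h' p" using height_eq_iff assms p by blast
  then show ?thesis using ratio_estimate[of "align y p" r s] assms p align[OF p] by simp
qed

lemma chord_height'_tendsto:
  "((\<lambda>y. chord \<bar>h' p - h' (align y p)\<bar>) \<longlongrightarrow> 0) (at (h p))"
proof (rule tendsto_sandwich)
  \<comment> \<open>Below \<open>a p q / 4\<close> the error \<open>2 * e * e'\<close> of the ratio
    estimate is at most half of \<open>a p q * e'\<close> and can be absorbed.\<close>
  have "eventually (\<lambda>y. chord \<bar>h p - y\<bar> < a p q / 4) (at (h p))"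
    using chord_abs_tendsto pos by (intro order_tendstoD) auto
  with eventually_near
  show "eventually (\<lambda>y. chord \<bar>h' p - h' (align y p)\<bar> \<le> 2 * a' p q / a p q * chord \<bar>h p - y\<bar>) (at (h p))"
  proof eventually_elim
    case (elim y)
    define e where "e = chord \<bar>h p - y\<bar>"
    define e' where "e' = chord \<bar>h' p - h' (align y p)\<bar>"
    have e': "e' > 0" using height_close[of p "align y p"] elim p align[OF p] chord_pos
      by (simp add: e'_def)
    have "\<bar>a p q * e' - a' p q * e\<bar> \<le> 2 * e * e'"
      using ratio_estimate_align[OF _ _ p q refl pq[symmetric], of y] elim by (simp add: e_def e'_def)
    moreover have "2 * e * e' \<le> a p q / 2 * e'"
      using elim e' by (intro mult_right_mono) (auto simp: e_def)
    ultimately have "a p q / 2 * e' \<le> a' p q * e" by (simp add: abs_le_iff)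
    then have "e' \<le> 2 * a' p q / a p q * e" using pos by (simp add: field_simps)
    then show ?case by (simp add: e_def e'_def)
  qed
  show "eventually (\<lambda>y. 0 \<le> chord \<bar>h' p - h' (align y p)\<bar>) (at (h p))"
    using eventually_near
  proof eventually_elim
    case (elim y)
    then show ?case using height_close[of p "align y p"] p align[OF p] chord_pos
      by (simp add: less_imp_le)
  qed
  show "((\<lambda>y. 2 * a' p q / a p q * chord \<bar>h p - y\<bar>) \<longlongrightarrow> 0) (at (h p))"
    by (intro tendsto_mult_right_zero chord_abs_tendsto)
qed simp

text \<open>Both ratios of distances are approximated by the same ratio \<open>e' / e\<close> of
  chords; eliminating it leaves an error proportional to \<open>e'\<close>, which tends to
  0.\<close>

lemma ratio_eq:
  assumes r: "r \<in> P" "s \<in> P" "h r = h p" "h s = h p"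
  shows "a' r s = a' p q / a p q * a r s"
proof -
  have "\<bar>a' r s * a p q - a' p q * a r s\<bar> \<le> 0"
  proof (rule tendsto_lowerbound)
    show "((\<lambda>y. 2 * (a p q + a r s) * chord \<bar>h' p - h' (align y p)\<bar>) \<longlongrightarrow> 0) (at (h p))"
      by (intro tendsto_mult_right_zero chord_height'_tendsto)
    show "eventually (\<lambda>y. \<bar>a' r s * a p q - a' p q * a r s\<bar>
        \<le> 2 * (a p q + a r s) * chord \<bar>h' p - h' (align y p)\<bar>) (at (h p))"
      using eventually_near
    proof eventually_elim
      case (elim y)
      define e where "e = chord \<bar>h p - y\<bar>"
      define e' where "e' = chord \<bar>h' p - h' (align y p)\<bar>"
      have e: "e > 0" using elim chord_pos by (simp add: e_def)
      have A: "\<bar>a p q * e' - a' p q * e\<bar> \<le> 2 * e * e'" "\<bar>a r s * e' - a' r s * e\<bar> \<le> 2 * e * e'"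
        using ratio_estimate_align[OF _ _ p q refl pq[symmetric], of y]
          ratio_estimate_align[OF _ _ r, of y] elim by (simp_all add: e_def e'_def)
      have "(a' r s * a p q - a' p q * a r s) * e
        = a r s * (a p q * e' - a' p q * e) - a p q * (a r s * e' - a' r s * e)"
        by (simp add: algebra_simps)
      then have "\<bar>a' r s * a p q - a' p q * a r s\<bar> * e
        = \<bar>a r s * (a p q * e' - a' p q * e) - a p q * (a r s * e' - a' r s * e)\<bar>"
        using e by (metis abs_mult abs_of_pos)
      also have "\<dots> \<le> \<bar>a r s * (a p q * e' - a' p q * e)\<bar> + \<bar>a p q * (a r s * e' - a' r s * e)\<bar>"
        by (rule abs_triangle_ineq4)
      also have "\<dots> \<le> a r s * (2 * e * e') + a p q * (2 * e * e')"
        using A pos a_nonneg[of r s] r by (intro add_mono) (auto simp: abs_mult intro!: mult_left_mono)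
      also have "\<dots> = (2 * (a p q + a r s) * e') * e" by (simp add: algebra_simps)
      finally show ?case using e by (simp add: e'_def)
    qed
  qed auto
  then show ?thesis using pos by (simp add: field_simps)
qed

text \<open>The quotient of chords tends to \<open>a' p q / a p q\<close>. Its square has the same
  limit as the quotient of the height differences, which is the difference quotient because
  \<open>h'\<close> increases with \<open>h\<close>.\<close>

lemma height'_has_derivative:
  "((\<lambda>y. h' (align y p)) has_real_derivative (a' p q / a p q)\<^sup>2) (at (h p))"
proof -
  let ?E = "\<lambda>y. \<bar>h p - y\<bar>" and ?D = "\<lambda>y. \<bar>h' p - h' (align y p)\<bar>"
  have near: "eventually (\<lambda>y. 0 < ?E y \<and> ?E y < 1 \<and> 0 < ?D y \<and> ?D y < 1) (at (h p))"
    using eventually_near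
  proof eventually_elim
    case (elim y)
    then show ?case using height_close[of p "align y p"] p align[OF p] by simp
  qed
  have "((\<lambda>y. chord (?D y) / chord (?E y) - a' p q / a p q) \<longlongrightarrow> 0) (at (h p))"
  proof (rule Lim_null_comparison)
    show "eventually (\<lambda>y. norm (chord (?D y) / chord (?E y) - a' p q / a p q)
        \<le> 2 / a p q * chord (?D y)) (at (h p))"
      using near
    proof eventually_elim
      case (elim y)
      have e: "chord (?E y) > 0" using elim chord_pos by blast
      have "chord (?D y) / chord (?E y) - a' p q / a p q
          = (a p q * chord (?D y) - a' p q * chord (?E y)) / (a p q * chord (?E y))"
        using e pos by (simp add: field_simps)
      also have "norm \<dots> = \<bar>a p q * chord (?D y) - a' p q * chord (?E y)\<bar> / (a p q * chord (?E y))"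
        using e pos by (simp add: abs_mult)
      also have "\<dots> \<le> (2 * chord (?E y) * chord (?D y)) / (a p q * chord (?E y))"
        using ratio_estimate_align[OF _ _ p q refl pq[symmetric], of y] elim e pos
        by (intro divide_right_mono) auto
      also have "\<dots> = 2 / a p q * chord (?D y)" using e by simp
      finally show ?case .
    qed
    show "((\<lambda>y. 2 / a p q * chord (?D y)) \<longlongrightarrow> 0) (at (h p))"
      by (intro tendsto_mult_right_zero chord_height'_tendsto)
  qed
  then have ratio: "((\<lambda>y. chord (?D y) / chord (?E y)) \<longlongrightarrow> a' p q / a p q) (at (h p))"
    by (rule LIM_zero_cancel)
  have D: "(?D \<longlongrightarrow> 0) (at (h p))"
  proof (rule Lim_null_comparison)
    show "eventually (\<lambda>y. norm (?D y) \<le> (chord (?D y))\<^sup>2) (at (h p))"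
      using near
    proof eventually_elim
      case (elim y)
      then show ?case using le_chord_squared[of "?D y"] by simp
    qed
    show "((\<lambda>y. (chord (?D y))\<^sup>2) \<longlongrightarrow> 0) (at (h p))"
      using tendsto_power[OF chord_height'_tendsto, of 2] by simp
  qed
  have E: "(?E \<longlongrightarrow> 0) (at (h p))"
    by (rule tendsto_eq_intros refl | simp)+
  have "((\<lambda>y. (chord (?D y) / chord (?E y))\<^sup>2 * ((2 - ?E y) / (2 - ?D y)))
      \<longlongrightarrow> (a' p q / a p q)\<^sup>2 * ((2 - 0) / (2 - 0))) (at (h p))"
    by (intro tendsto_intros ratio D E) auto
  then have "((\<lambda>y. (chord (?D y) / chord (?E y))\<^sup>2 * ((2 - ?E y) / (2 - ?D y)))
      \<longlongrightarrow> (a' p q / a p q)\<^sup>2) (at (h p))" by simp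
  moreover have "eventually (\<lambda>y. (chord (?D y) / chord (?E y))\<^sup>2 * ((2 - ?E y) / (2 - ?D y))
      = (h' (align y p) - h' (align (h p) p)) / (y - h p)) (at (h p))"
    using near
  proof eventually_elim
    case (elim y)
    have "h' (align (h p) p) = h' p" using height_eq_iff[of "align (h p) p" p] align[OF p] p by blast
    moreover have "h' (align y p) < h' p \<longleftrightarrow> y < h p"
      using height_less_iff[of "align y p" p] align[OF p] p by simp
    ultimately have *: "(h' (align y p) - h' (align (h p) p)) / (y - h p) = ?D y / ?E y"
      using elim by (auto simp: abs_if field_simps)
    have "(chord (?D y) / chord (?E y))\<^sup>2 * ((2 - ?E y) / (2 - ?D y)) = ?D y / ?E y"
      using elim by (intro chord_quotient) auto
    then show ?case using * by simp
  qed
  ultimately show ?thesis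
    unfolding has_field_derivative_iff by (rule Lim_transform_eventually)
qed

text \<open>On a slice the unit balls agree, so scaling by \<open>k\<close> respects the threshold
  1. The segment from \<open>R\<close> to \<open>S\<close> is long enough to contain points at
  distances 1 and \<open>1 / k\<close> from \<open>R\<close>; testing them gives
  \<open>k \<le> 1\<close> and \<open>1 \<le> k\<close>.\<close>

lemma ratio_eq_one_if_large:
  assumes "r \<in> P" "s \<in> P" "a r s > 1"
  shows "a' p q / a p q = 1"
proof -
  define k where "k = a' p q / a p q"
  define R where "R = align (h p) r"
  define S where "S = align (h p) s"
  have RS: "R \<in> P" "S \<in> P" "h R = h p" "h S = h p" "a R S > 1"
    using align[of r] align[of s] assms by (auto simp: R_def S_def)
  have unit: "a R T \<le> 1 \<longleftrightarrow> k * a R T \<le> 1" if T: "T \<in> P" "h T = h p" for T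
  proof -
    have "h' T = h' R" using height_eq_iff RS T by simp
    then have "(a R T)\<^sup>2 \<le> 1 \<longleftrightarrow> (a' R T)\<^sup>2 \<le> 1" using balls[of R T 1] RS T by simp
    then have "a R T \<le> 1 \<longleftrightarrow> a' R T \<le> 1"
      using a_nonneg[of R T] L'.a_nonneg[of R T] RS T by (simp add: abs_square_le_1)
    then show ?thesis using ratio_eq[of R T] RS T by (simp add: k_def)
  qed
  have big: "k * a R S > 1" using unit[of S] RS by auto
  then have "0 < k * a R S" by linarith
  then have k: "k > 0" using RS(5) by (simp add: zero_less_mult_iff)
  have "k \<le> 1"
  proof -
    obtain T where "T \<in> P" "h T = h R" "a R T = 1 / a R S * a R S"
      using between[of R S "1 / a R S"] RS by auto
    then show ?thesis using unit[of T] RS by auto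
  qed
  moreover have "1 \<le> k"
  proof -
    obtain T where "T \<in> P" "h T = h R" "a R T = 1 / (k * a R S) * a R S"
      using between[of R S "1 / (k * a R S)"] RS big by auto
    then have T: "a R T \<le> 1" "k * a R T = 1" using unit[of T] RS k by auto
    have "k * a R T \<le> k * 1" using T k by (intro mult_left_mono) auto
    then show ?thesis using T by simp
  qed
  ultimately show ?thesis by (simp add: k_def)
qed

end

text \<open>Any pair can be moved, keeping \<open>a\<close>, to the slice of \<open>p\<close> and
  then, keeping \<open>a'\<close>, to that of \<open>r\<close>. This gives
  \<open>k * a x y \<le> l * S\<close> with \<open>S\<close> the supremum of \<open>a\<close>,
  finite by \<open>bounded\<close>; taking the supremum on the left and cancelling \<open>S\<close>
  compares the factors.\<close>

lemma ratio_le_if_bounded: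
  assumes p: "p \<in> P" "q \<in> P" "h p = h q" "a p q > 0"
    and r: "r \<in> P" "s \<in> P" "h r = h s" "a r s > 0"
    and bounded: "\<And>x y. x \<in> P \<Longrightarrow> y \<in> P \<Longrightarrow> a x y \<le> 1"
  shows "a' p q / a p q \<le> a' r s / a r s"
proof -
  define k l where "k = a' p q / a p q" and "l = a' r s / a r s"
  have kl: "0 \<le> k" "0 \<le> l" using L'.a_nonneg p r by (auto simp: k_def l_def)
  define S where "S = Sup {a x y |x y. x \<in> P \<and> y \<in> P}"
  have S: "a x y \<le> S" if "x \<in> P" "y \<in> P" for x y
    unfolding S_def using that bounded by (intro cSup_upper bdd_aboveI[of _ 1]) auto
  have *: "k * a x y \<le> l * S" if xy: "x \<in> P" "y \<in> P" for x y
  proof -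
    define x1 y1 where "x1 = align (h p) x" and "y1 = align (h p) y"
    define x2 y2 where "x2 = L'.align (h' r) x1" and "y2 = L'.align (h' r) y1"
    have 1: "x1 \<in> P" "y1 \<in> P" "h x1 = h p" "h y1 = h p" "a x1 y1 = a x y"
      using align[of x] align[of y] xy by (auto simp: x1_def y1_def)
    have 2: "x2 \<in> P" "y2 \<in> P" "h' x2 = h' r" "h' y2 = h' r" "a' x2 y2 = a' x1 y1"
      using L'.align[of x1] L'.align[of y1] 1 by (auto simp: x2_def y2_def)
    have "h x2 = h r" "h y2 = h r" using height_eq_iff 2 r by blast+
    then have "a' x2 y2 = l * a x2 y2" using ratio_eq[OF r] 2 by (simp add: l_def)
    moreover have "a' x1 y1 = k * a x y" using ratio_eq[OF p] 1 by (simp add: k_def)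
    ultimately show ?thesis using S[of x2 y2] 2 kl by (metis mult_left_mono)
  qed
  have "k \<le> l"
  proof (cases "k = 0")
    case False
    with kl have k: "k > 0" by simp
    have "S \<le> l * S / k"
      unfolding S_def
    proof (rule cSup_least)
      show "{a x y |x y. x \<in> P \<and> y \<in> P} \<noteq> {}" using p by blast
    next
      fix t assume "t \<in> {a x y |x y. x \<in> P \<and> y \<in> P}"
      then show "t \<le> l * Sup {a x y |x y. x \<in> P \<and> y \<in> P} / k"
        using * k by (auto simp: S_def field_simps)
    qed
    moreover have "S > 0" using S[of p q] p by simp
    ultimately show ?thesis using k by (simp add: field_simps)
  qed (use kl in auto)
  then show ?thesis by (simp add: k_def l_def)
qed

lemma ratio_constant:
  assumes p: "p \<in> P" "q \<in> P" "h p = h q" "a p q > 0"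
    and r: "r \<in> P" "s \<in> P" "h r = h s" "a r s > 0"
  shows "a' p q / a p q = a' r s / a r s"
proof (cases "\<exists>x\<in>P. \<exists>y\<in>P. a x y > 1")
  case True
  then show ?thesis using ratio_eq_one_if_large p r by metis
next
  case False
  then show ?thesis using ratio_le_if_bounded[OF p r] ratio_le_if_bounded[OF r p] by force
qed

section \<open>Equality of the two product structures\<close>

context
  fixes u v
  assumes u: "u \<in> P" and v: "v \<in> P" and thick: "a u v > 0"
begin

lemma align_thick:
  "align x u \<in> P" "align x v \<in> P" "h (align x u) = x" "h (align x v) = x"
  "a (align x u) (align x v) = a u v"
  using align[OF u] align[OF v] u v by auto

text \<open>As a function \<open>f\<close> of \<open>h\<close>, the height \<open>h'\<close> has the
  constant derivative \<open>k\<^sup>2\<close>, and the unit translation raises both heights by 1,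
  so \<open>k = 1\<close>. Transversal distances are compared at equal heights only, since the
  \<open>\<tau>\<close>-lines have yet to be shown vertical for the second structure.\<close>

lemma same_metric_aux:
  shows "p \<in> P \<Longrightarrow> q \<in> P \<Longrightarrow> h' p - h' q = h p - h q"
    and "p \<in> P \<Longrightarrow> q \<in> P \<Longrightarrow> h p = h q \<Longrightarrow> a' p q = a p q"
proof -
  define f where "f y = h' (align y u)" for y
  define k where "k = a' (align 0 u) (align 0 v) / a (align 0 u) (align 0 v)"
  have k: "a' (align x u) (align x v) / a (align x u) (align x v) = k" for x
    unfolding k_def using align_thick thick by (intro ratio_constant) auto
  have h': "h' p = f (h p)" if "p \<in> P" for p
    using height_eq_iff[of p "align (h p) u"] align_thick that by (simp add: f_def)
  have deriv: "(f has_real_derivative k\<^sup>2) (at x)" for x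
  proof -
    have "h' (align y (align x u)) = f y" for y
      using h'[of "align y (align x u)"] align align_thick by simp
    then show ?thesis
      using height'_has_derivative[of "align x u" "align x v"] align_thick thick k by simp
  qed
  have "((\<lambda>x. f x - k\<^sup>2 * x) has_real_derivative 0) (at x)" for x
    by (rule derivative_eq_intros deriv refl | simp)+
  then have const: "f x - k\<^sup>2 * x = f y - k\<^sup>2 * y" for x y
    using DERIV_isconst_all by blast
  have "f 1 = f 0 + 1"
  proof -
    obtain r where "r \<in> P" "h r = h (align 0 u) + real 1" "h' r = h' (align 0 u) + real 1"
      using unit_shifts[of "align 0 u" 1] align_thick by auto
    then show ?thesis using h'[of r] h'[of "align 0 u"] align_thick by simp
  qed
  then have k2: "k\<^sup>2 = 1" using const[of 1 0] by simp
  then show "h' p - h' q = h p - h q" if "p \<in> P" "q \<in> P"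
    using const[of "h p" "h q"] h' that by simp
  have "0 \<le> k" unfolding k_def using L'.a_nonneg a_nonneg align_thick by (metis divide_nonneg_nonneg)
  with k2 have "k = 1" by (simp add: power2_eq_1_iff)
  show "a' p q = a p q" if "p \<in> P" "q \<in> P" "h p = h q"
  proof -
    let ?u = "align (h p) u" and ?v = "align (h p) v"
    have "a' p q = a' ?u ?v / a ?u ?v * a p q"
      using align_thick thick that by (intro ratio_eq) auto
    then show ?thesis unfolding k \<open>k = 1\<close> by simp
  qed
qed

text \<open>Subdividing a fixed orbit segment, the radius of the common ball can be made arbitrarily small.\<close>
lemma orbit_balls:
  assumes "p \<in> P" "r \<in> P" "0 < \<bar>s\<bar>" "\<bar>s\<bar> < 1"
  shows "a' (\<tau> (real i * s) p) r \<le> chord \<bar>s\<bar> \<longleftrightarrow> a' (\<tau> (real (Suc i) * s) p) r \<le> chord \<bar>s\<bar>"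
proof -
  define x y where "x = \<tau> (real i * s) p" and "y = \<tau> (real (Suc i) * s) p"
  have xy: "x \<in> P" "y \<in> P" "h x - h y = - s" "\<And>t. t \<in> P \<Longrightarrow> a x t = a p t"
      "\<And>t. t \<in> P \<Longrightarrow> a y t = a p t"
    using assms by (auto simp: x_def y_def tau_mem h_tau a_tau algebra_simps)
  \<comment> \<open>\<open>t\<close> has the height of \<open>y\<close>, where both structures agree
    on the distance to \<open>y\<close>. Since \<open>a x t = a y t\<close>,
    \<open>close_iff\<close> carries the bound over to \<open>x\<close>.\<close>
  define t where "t = L'.align (h' y) r"
  have t: "t \<in> P" "h' t = h' y" "a' x t = a' x r" "a' y t = a' y r"
    using L'.align[OF assms(2)] xy by (auto simp: t_def)
  then have ht: "h t = h y" using height_eq_iff xy by blast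
  have "h' x - h' t = h x - h y" using same_metric_aux(1)[of x t] xy t ht by simp
  then have "a' x t \<le> chord \<bar>s\<bar> \<longleftrightarrow> a x t \<le> chord \<bar>s\<bar>"
    using close_iff[of x t] xy(1-3) t(1) ht assms(3,4) by simp
  moreover have "a x t = a' y t"
    using same_metric_aux(2)[OF xy(2) t(1) ht[symmetric]] xy(4,5)[OF t(1)] by simp
  ultimately have "a' x r \<le> chord \<bar>s\<bar> \<longleftrightarrow> a' y r \<le> chord \<bar>s\<bar>" unfolding t(3,4) by simp
  then show ?thesis unfolding x_def y_def .
qed

text \<open>Starting from \<open>a' p p = 0\<close>, \<open>orbit_balls\<close> keeps the orbit
  within \<open>chord \<bar>s / real n\<bar>\<close> of \<open>p\<close> during \<open>n\<close>
  steps of size \<open>s / n\<close>, and this radius tends to 0.\<close>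

lemma orbit_vertical:
  assumes "p \<in> P"
  shows "a' (\<tau> s p) p = 0"
proof (cases "s = 0")
  case True
  then show ?thesis using tau_zero L'.a_self assms by simp
next
  case False
  have "a' (\<tau> s p) p \<le> 0"
  proof (rule tendsto_lowerbound)
    show "((\<lambda>n. chord \<bar>s / real n\<bar>) \<longlongrightarrow> 0) sequentially"
      by (intro chord_tendsto_zero tendsto_rabs_zero lim_const_over_n)
    show "eventually (\<lambda>n. a' (\<tau> s p) p \<le> chord \<bar>s / real n\<bar>) sequentially"
      using eventually_gt_at_top[of "nat \<lceil>\<bar>s\<bar>\<rceil>"]
    proof eventually_elim
      case (elim n)
      then have n: "\<bar>s\<bar> < real n" by linarith
      then have sn: "0 < \<bar>s / real n\<bar>" "\<bar>s / real n\<bar> < 1" using False by auto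
      have "a' (\<tau> (real i * (s / real n)) p) p \<le> chord \<bar>s / real n\<bar>" for i
      proof (induction i)
        case 0
        show ?case using chord_pos[OF sn] tau_zero[OF assms] L'.a_self[OF assms] by simp
      next
        case (Suc i)
        then show ?case using orbit_balls[OF assms assms sn, of i] by blast
      qed
      from this[of n] show ?case using n by simp
    qed
  qed auto
  then show ?thesis using L'.a_nonneg[of "\<tau> s p" p] assms tau_mem by force
qed

theorem same_metric:
  assumes p: "p \<in> P" and q: "q \<in> P"
  shows "h' p - h' q = h p - h q" "a' p q = a p q"
proof -
  \<comment> \<open>Moving \<open>q\<close> to the height of \<open>p\<close> changes neither
    \<open>a\<close> nor, by \<open>orbit_vertical\<close>, \<open>a'\<close>.\<close>
  define r where "r = align (h p) q"
  have r: "r \<in> P" "h r = h p" "a p r = a p q" using align[OF q] p by (auto simp: r_def)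
  have "a' r q = 0" "a' q r = 0" using orbit_vertical[OF q] L'.a_sym[of q r] by (auto simp: r_def align_def)
  then have "a' p q = a' p r"
    using L'.a_triangle[of p q r] L'.a_triangle[of p r q] p q r by simp
  then show "a' p q = a p q" using same_metric_aux(2)[of p r] p r by simp
  show "h' p - h' q = h p - h q" using same_metric_aux(1) p q by blast
qed

end

end

section \<open>The parallel set of a line\<close>

context cat0
begin

definition parallel :: "(real \<Rightarrow> 'a) \<Rightarrow> (real \<Rightarrow> 'a) \<Rightarrow> bool" where
  "parallel c l \<longleftrightarrow> complete_geodesic X d l \<and> (\<exists>B. \<forall>t. d (l t) (c t) \<le> B)"

text \<open>Evaluation at 0 loses nothing, because shifts of a parallel line are parallel: this is
  the union of the parallel lines.\<close>

definition parallel_set :: "(real \<Rightarrow> 'a) \<Rightarrow> 'a set" where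
  "parallel_set c = {l 0 | l. parallel c l}"

definition line_through :: "(real \<Rightarrow> 'a) \<Rightarrow> 'a \<Rightarrow> real \<Rightarrow> 'a" where
  "line_through c p = (SOME l. parallel c l \<and> l 0 = p)"

text \<open>The formula solves \<open>(d (c s) p)\<^sup>2 = (s - x)\<^sup>2 + A\<^sup>2\<close> at \<open>s = 0, 1\<close> for the height \<open>x\<close> of \<open>p\<close>.\<close>
definition height :: "(real \<Rightarrow> 'a) \<Rightarrow> 'a \<Rightarrow> real" where
  "height c p = ((d (c 0) p)\<^sup>2 - (d (c 1) p)\<^sup>2 + 1) / 2"

text \<open>On the parallel set this is the distance between the parallel lines through
  \<open>p\<close> and \<open>q\<close>.\<close>

definition transversal :: "(real \<Rightarrow> 'a) \<Rightarrow> 'a \<Rightarrow> 'a \<Rightarrow> real" where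
  "transversal c p q = sqrt ((d p q)\<^sup>2 - (height c p - height c q)\<^sup>2)"

context
  fixes c
  assumes c: "complete_geodesic X d c"
begin

lemma parallel_imp_geodesic: "parallel c l \<Longrightarrow> complete_geodesic X d l"
  by (simp add: parallel_def)

lemma parallel_self: "parallel c c"
  using c by (auto simp: parallel_def complete_geodesic_def)

lemma parallel_bounded:
  assumes "parallel c l" "parallel c m"
  obtains B where "\<And>t. d (l t) (m t) \<le> B"
proof -
  obtain B1 B2 where "\<And>t. d (l t) (c t) \<le> B1" "\<And>t. d (m t) (c t) \<le> B2"
    using assms by (auto simp: parallel_def)
  moreover have "d (l t) (m t) \<le> d (l t) (c t) + d (m t) (c t)" for t
    using triangle[of "l t" "c t" "m t"] assms c commute
    by (simp add: parallel_def complete_geodesic_def)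
  ultimately have "d (l t) (m t) \<le> B1 + B2" for t by (meson add_mono order_trans)
  then show ?thesis using that by blast
qed

lemma parallel_dist_offset:
  assumes "parallel c l" "parallel c m"
  obtains b A where "0 \<le> A" "\<And>s u. (d (l s) (m u))\<^sup>2 = (u - s - b)\<^sup>2 + A\<^sup>2"
  using parallel_lines_dist parallel_bounded assms parallel_imp_geodesic by metis

lemma height_offset:
  assumes "\<And>s u. (d (c s) (l u))\<^sup>2 = (u - s - b)\<^sup>2 + A\<^sup>2"
  shows "height c (l u) = u - b"
proof -
  have "(u - b)\<^sup>2 - (u - 1 - b)\<^sup>2 + 1 = 2 * (u - b)" by (simp add: power2_eq_square algebra_simps)
  then show ?thesis by (simp add: height_def assms)
qed

lemma height_parallel:
  assumes "parallel c l"
  shows "height c (l s) = height c (l 0) + s"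
proof -
  obtain b A where "\<And>s u. (d (c s) (l u))\<^sup>2 = (u - s - b)\<^sup>2 + A\<^sup>2"
    using parallel_dist_offset[OF parallel_self assms] by metis
  then have "height c (l u) = u - b" for u by (rule height_offset)
  then show ?thesis by simp
qed

text \<open>Heights record the offsets from \<open>c\<close>, and additivity of offsets along
  \<open>c\<close>, \<open>l\<close>, \<open>m\<close> expresses the offset between \<open>l\<close>
  and \<open>m\<close> through them.\<close>

lemma parallel_dist:
  assumes l: "parallel c l" and m: "parallel c m"
  obtains A where "0 \<le> A" "\<And>s u. (d (l s) (m u))\<^sup>2 = (height c (l s) - height c (m u))\<^sup>2 + A\<^sup>2"
proof -
  obtain b1 A1 where 1: "\<And>s u. (d (c s) (l u))\<^sup>2 = (u - s - b1)\<^sup>2 + A1\<^sup>2"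
    using parallel_dist_offset[OF parallel_self l] by metis
  obtain b2 A2 where 2: "\<And>s u. (d (c s) (m u))\<^sup>2 = (u - s - b2)\<^sup>2 + A2\<^sup>2"
    using parallel_dist_offset[OF parallel_self m] by metis
  obtain b A where A: "0 \<le> A" and 3: "\<And>s u. (d (l s) (m u))\<^sup>2 = (u - s - b)\<^sup>2 + A\<^sup>2"
    using parallel_dist_offset[OF l m] by metis
  have "b1 + b = b2"
    using offset_additive[OF c _ _ 1 3 2] l m parallel_imp_geodesic by blast
  moreover have "height c (l s) = s - b1" "height c (m s) = s - b2" for s
    using height_offset 1 2 by blast+
  ultimately have "u - s - b = height c (m u) - height c (l s)" for s u by simp
  then have "(d (l s) (m u))\<^sup>2 = (height c (l s) - height c (m u))\<^sup>2 + A\<^sup>2" for s u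
    using 3[of s u] power2_commute[of "height c (m u)"] by simp
  then show ?thesis using that A by blast
qed

lemma parallel_dist_transversal:
  assumes "parallel c l" "parallel c m"
  shows "(d (l s) (m u))\<^sup>2 = (height c (l s) - height c (m u))\<^sup>2 + (transversal c (l 0) (m 0))\<^sup>2"
    and "transversal c (l s) (m u) = transversal c (l 0) (m 0)"
    and "0 \<le> transversal c (l s) (m u)"
proof -
  obtain A where A: "0 \<le> A" "\<And>s u. (d (l s) (m u))\<^sup>2 = (height c (l s) - height c (m u))\<^sup>2 + A\<^sup>2"
    using parallel_dist assms by blast
  then have T: "transversal c (l s) (m u) = A" for s u by (simp add: transversal_def)
  show "(d (l s) (m u))\<^sup>2 = (height c (l s) - height c (m u))\<^sup>2 + (transversal c (l 0) (m 0))\<^sup>2"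
    "transversal c (l s) (m u) = transversal c (l 0) (m 0)" "0 \<le> transversal c (l s) (m u)"
    using A T by simp_all
qed

lemma parallel_unique:
  assumes l: "parallel c l" and m: "parallel c m" and eq: "l 0 = m 0"
  shows "l = m"
proof
  fix s
  have X: "l t \<in> X" "m t \<in> X" for t using l m parallel_imp_geodesic complete_geodesic_mem by blast+
  have "transversal c (l 0) (m 0) = 0" using eq X[of 0] by (simp add: transversal_def)
  moreover have "height c (l s) = height c (m s)" using height_parallel l m eq by metis
  ultimately have "(d (l s) (m s))\<^sup>2 = 0" using parallel_dist_transversal(1)[OF l m, of s s] by simp
  then show "l s = m s" using X by simp
qed

lemma parallel_shift:
  assumes "parallel c l"
  shows "parallel c (\<lambda>t. l (s + t))"
proof -
  obtain B where B: "\<And>t. d (l t) (c t) \<le> B" and l: "complete_geodesic X d l"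
    using assms by (auto simp: parallel_def)
  have "d (l (s + t)) (c t) \<le> \<bar>s\<bar> + B" for t
  proof -
    have "d (l (s + t)) (c t) \<le> d (l (s + t)) (l t) + d (l t) (c t)"
      using triangle l c complete_geodesic_mem by blast
    then show ?thesis using B[of t] l by (simp add: complete_geodesic_dist)
  qed
  moreover have "complete_geodesic X d (\<lambda>t. l (s + t))" using l by (simp add: complete_geodesic_def)
  ultimately show ?thesis by (auto simp: parallel_def)
qed

lemma line_through:
  assumes "p \<in> parallel_set c"
  shows "parallel c (line_through c p)" "line_through c p 0 = p"
proof -
  have "\<exists>l. parallel c l \<and> l 0 = p" using assms by (auto simp: parallel_set_def)
  then have "parallel c (line_through c p) \<and> line_through c p 0 = p"
    unfolding line_through_def by (rule someI_ex)
  then show "parallel c (line_through c p)" "line_through c p 0 = p" by auto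
qed

lemma line_through_eq:
  assumes "parallel c l"
  shows "line_through c (l 0) = l"
proof -
  have "l 0 \<in> parallel_set c" using assms by (auto simp: parallel_set_def)
  then show ?thesis using parallel_unique line_through assms by blast
qed

lemma parallel_mem:
  assumes "parallel c l"
  shows "l t \<in> parallel_set c"
  unfolding parallel_set_def using parallel_shift[OF assms, of t]
  by (intro CollectI exI[of _ "\<lambda>s. l (t + s)"]) simp

lemma parallel_set_subset: "parallel_set c \<subseteq> X"
  using parallel_imp_geodesic complete_geodesic_mem by (auto simp: parallel_set_def)

lemma parallel_set_dist:
  assumes "p \<in> parallel_set c" "q \<in> parallel_set c"
  shows "(d p q)\<^sup>2 = (height c p - height c q)\<^sup>2 + (transversal c p q)\<^sup>2"
  using parallel_dist_transversal(1)[OF line_through(1)[OF assms(1)] line_through(1)[OF assms(2)], of 0 0]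
  by (simp add: line_through assms)

lemma parallel_set_between:
  assumes p: "p \<in> parallel_set c" and q: "q \<in> parallel_set c" and pq: "height c p = height c q"
    and k: "0 \<le> k" "k \<le> 1"
  shows "\<exists>r\<in>parallel_set c. height c r = height c p \<and>
    transversal c p r = k * transversal c p q \<and> transversal c r q = (1 - k) * transversal c p q"
proof -
  define l m A where "l = line_through c p" and "m = line_through c q" and "A = transversal c p q"
  have l: "parallel c l" "l 0 = p" and m: "parallel c m" "m 0 = q"
    using line_through p q by (auto simp: l_def m_def)
  have A: "0 \<le> A" using parallel_dist_transversal(3)[OF l(1) m(1), of 0 0] l m by (simp add: A_def)
  have lm: "(d (l s) (m u))\<^sup>2 = (u - s)\<^sup>2 + A\<^sup>2" for s u
    using parallel_dist_transversal(1)[OF l(1) m(1), of s u]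
      height_parallel[OF l(1), of s] height_parallel[OF m(1), of u] l m pq
    by (simp add: A_def power2_commute)
  obtain r where r: "complete_geodesic X d r" "\<And>s. d (l s) (r s) = k * A"
      "\<And>s. d (r s) (m s) = (1 - k) * A" "\<And>s u. (d (l s) (r u))\<^sup>2 \<le> (u - s)\<^sup>2 + (k * A)\<^sup>2"
    using intermediate_line[OF _ _ lm A k] l m parallel_imp_geodesic by metis
  obtain B where B: "\<And>t. d (l t) (c t) \<le> B" using l by (auto simp: parallel_def)
  have "d (r t) (c t) \<le> k * A + B" for t
    using triangle[of "r t" "l t" "c t"] r(1) l c parallel_imp_geodesic complete_geodesic_mem
      B[of t] r(2)[of t] commute[of "r t" "l t"] by force
  then have par: "parallel c r" using r by (auto simp: parallel_def)
  define e where "e = height c (l 0) - height c (r 0)"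
  have "e = 0"
  proof (rule ccontr)
    assume e: "e \<noteq> 0"
    \<comment> \<open>Chosen so that \<open>2 * s * e\<close> exceeds
      \<open>(k * A)\<^sup>2\<close>: sliding along \<open>l\<close> against a height offset breaks
      the quadratic bound on \<open>d (l s) (r 0)\<close>.\<close>
    define s where "s = ((k * A)\<^sup>2 + 1) / (2 * e)"
    have "(s + e)\<^sup>2 \<le> (d (l s) (r 0))\<^sup>2"
      using parallel_dist_transversal(1)[OF l(1) par, of s 0] height_parallel[OF l(1), of s]
      by (simp add: e_def algebra_simps)
    also have "\<dots> \<le> s\<^sup>2 + (k * A)\<^sup>2" using r(4)[of s 0] by simp
    finally have "2 * s * e + e\<^sup>2 \<le> (k * A)\<^sup>2" by (simp add: power2_eq_square algebra_simps)
    moreover have "2 * s * e = (k * A)\<^sup>2 + 1" using e by (simp add: s_def)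
    ultimately show False using zero_le_power2[of e] by linarith
  qed
  then have hr: "height c (r 0) = height c p" using l by (simp add: e_def)
  have "transversal c p (r 0) = k * A" "transversal c (r 0) q = (1 - k) * A"
    using r(2)[of 0] r(3)[of 0] hr pq l m A k by (simp_all add: transversal_def)
  then show ?thesis using hr parallel_mem[OF par, of 0] by (auto simp: A_def)
qed

lemma line_product_parallel_set:
  "line_product (parallel_set c) (\<lambda>s p. line_through c p s) (height c) (transversal c)"
proof
  fix p q r and s k :: real
  assume p: "p \<in> parallel_set c"
  note l = line_through[OF p]
  show "line_through c p s \<in> parallel_set c" using parallel_mem l by blast
  show "height c (line_through c p s) = height c p + s" using height_parallel[OF l(1)] l(2) by simp
  show "transversal c p p = 0" using p parallel_set_subset by (auto simp: transversal_def)
  assume q: "q \<in> parallel_set c"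
  note m = line_through[OF q]
  show "transversal c (line_through c p s) q = transversal c p q"
    using parallel_dist_transversal(2)[OF l(1) m(1), of s 0] l m by simp
  show "0 \<le> transversal c p q"
    using parallel_dist_transversal(3)[OF l(1) m(1), of 0 0] l m by simp
  {
    assume "height c p = height c q" "transversal c p q = 0"
    then have "(d p q)\<^sup>2 = 0" using parallel_set_dist[OF p q] by simp
    then show "p = q" using p q parallel_set_subset zero[of p q] by auto
  }
  {
    assume r: "r \<in> parallel_set c"
    note n = line_through[OF r]
    have flat: "d x y = transversal c x y"
      if "x \<in> parallel_set c" "y \<in> parallel_set c" "height c x = height c y" for x y
      using that by (simp add: transversal_def)
    \<comment> \<open>After sliding \<open>q\<close> and \<open>r\<close> to the height of
      \<open>p\<close>, transversal distances are values of \<open>d\<close>, whose triangle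
      inequality applies.\<close>
    define y where "y = line_through c q (height c p - height c q)"
    define z where "z = line_through c r (height c p - height c r)"
    have y: "y \<in> parallel_set c" "height c y = height c p"
      using parallel_mem m height_parallel[OF m(1)] by (auto simp: y_def)
    have z: "z \<in> parallel_set c" "height c z = height c p"
      using parallel_mem n height_parallel[OF n(1)] by (auto simp: z_def)
    have "transversal c p y = transversal c p q"
      using parallel_dist_transversal(2)[OF l(1) m(1), of 0] l m by (simp add: y_def)
    moreover have "transversal c p z = transversal c p r"
      using parallel_dist_transversal(2)[OF l(1) n(1), of 0] l n by (simp add: z_def)
    moreover have "transversal c z y = transversal c r q"
      using parallel_dist_transversal(2)[OF n(1) m(1)] n m by (simp add: z_def y_def)
    moreover have "d p y \<le> d p z + d z y" using triangle p y z parallel_set_subset by blast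
    ultimately show "transversal c p q \<le> transversal c p r + transversal c r q"
      using flat[of p y] flat[of p z] flat[of z y] p y z by simp
  }
  {
    assume "height c p = height c q" "0 \<le> k" "k \<le> 1"
    then show "\<exists>r\<in>parallel_set c. height c r = height c p \<and> transversal c p r = k * transversal c p q
        \<and> transversal c r q = (1 - k) * transversal c p q"
      using parallel_set_between p q by blast
  }
next
  show "transversal c p q = transversal c q p" for p q
    by (simp add: transversal_def commute power2_commute)
qed

end

end

section \<open>Two metrics with the same unit balls\<close>

context cat0
begin

lemma between_le:
  assumes "x \<in> X" "y \<in> X" "z \<in> X" "m \<in> X" "0 \<le> k" "k \<le> 1"
    and "d x m = k * d x y" "d m y = (1 - k) * d x y" and R: "d z x \<le> R" "d z y \<le> R"
  shows "d z m \<le> R"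
proof -
  have "(d z x)\<^sup>2 \<le> R\<^sup>2" "(d z y)\<^sup>2 \<le> R\<^sup>2" using R by (auto intro: power_mono)
  then have "(1 - k) * (d z x)\<^sup>2 + k * (d z y)\<^sup>2 \<le> (1 - k) * R\<^sup>2 + k * R\<^sup>2"
    using assms by (intro add_mono mult_left_mono) auto
  moreover have "0 \<le> k * (1 - k) * (d x y)\<^sup>2" using assms by simp
  moreover have "(d z m)\<^sup>2 \<le> (1 - k) * (d z x)\<^sup>2 + k * (d z y)\<^sup>2 - k * (1 - k) * (d x y)\<^sup>2"
    using comparison assms by blast
  ultimately have "(d z m)\<^sup>2 \<le> R\<^sup>2" by (simp add: algebra_simps)
  moreover have "0 \<le> R" using R(1) nonneg[of z x] by linarith
  ultimately show ?thesis using power2_le_imp_le by blast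
qed

text \<open>Two comparisons suffice: of \<open>z\<close> with the segment from \<open>y\<close> to
  \<open>z'\<close>, which bounds \<open>d z x'\<close>, and of \<open>x'\<close> with the segment
  from \<open>y\<close> to \<open>z\<close>. For growing \<open>k\<close> the bound makes asymptotic
  rays from \<open>y\<close> coincide.\<close>

lemma diverging_segments:
  assumes X: "y \<in> X" "x \<in> X" "z \<in> X" "x' \<in> X" "z' \<in> X" and k: "0 \<le> k"
    and 1: "d y x = 1" "d x z = k" "d y z = k + 1" and 2: "d y x' = 1" "d x' z' = k" "d y z' = k + 1"
    and zz: "d z z' \<le> 1"
  shows "d x' x \<le> 1 / (k + 1)"
proof -
  define r where "r = 1 / (k + 1)"
  have r: "0 \<le> r" "r \<le> 1" "r * (k + 1) = 1" using k by (auto simp: r_def)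
  have "(d z x')\<^sup>2 \<le> (1 - r) * (d z y)\<^sup>2 + r * (d z z')\<^sup>2 - r * (1 - r) * (d y z')\<^sup>2"
    using X 2 r by (intro comparison) (auto simp: algebra_simps)
  also have "\<dots> \<le> (1 - r) * (k + 1)\<^sup>2 + r * 1 - r * (1 - r) * (k + 1)\<^sup>2"
    using mult_left_mono[OF power_le_one[OF nonneg zz, of 2] r(1)] 1 2 commute[of z y] by simp
  also have "\<dots> = (k + 1 - r * (k + 1))\<^sup>2 + r" by (simp add: power2_eq_square algebra_simps)
  finally have zx: "(d z x')\<^sup>2 \<le> k\<^sup>2 + r" using r by simp
  have "(d x' x)\<^sup>2 \<le> (1 - r) * (d x' y)\<^sup>2 + r * (d x' z)\<^sup>2 - r * (1 - r) * (d y z)\<^sup>2"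
    using X 1 r by (intro comparison) (auto simp: algebra_simps)
  also have "\<dots> \<le> (1 - r) * 1 + r * (k\<^sup>2 + r) - r * (1 - r) * (k + 1)\<^sup>2"
    using zx r 1 2 commute[of x' y] commute[of x' z] by (auto intro!: mult_left_mono)
  also have "\<dots> = r\<^sup>2 + (1 - r * (k + 1))\<^sup>2"
    by (simp add: power2_eq_square algebra_simps)
  finally have "(d x' x)\<^sup>2 \<le> r\<^sup>2" using r by simp
  then show ?thesis using r power2_le_imp_le by (auto simp: r_def)
qed

text \<open>Unit segments are concatenated. The triangle inequality bounds distances from above, and
  also from below, because the surrounding points of the sequence are already at full
  distance.\<close>

lemma integer_line_extends:
  assumes X: "\<And>i::int. x i \<in> X" and dist: "\<And>i j. d (x i) (x j) = \<bar>of_int i - of_int j\<bar>"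
  obtains l where "complete_geodesic X d l" "\<And>i. l (of_int i) = x i"
proof -
  have "\<forall>i. \<exists>g. geod_seg X d g (x i) (x (i + 1))" using geodesic_exists X by metis
  then obtain g where "\<And>i. geod_seg X d (g i) (x i) (x (i + 1))" by metis
  moreover have "d (x i) (x (i + 1)) = 1" for i by (simp add: dist)
  ultimately have g: "g i 0 = x i" "g i 1 = x (i + 1)" "\<And>s. s \<in> {0..1} \<Longrightarrow> g i s \<in> X"
    "\<And>s t. s \<in> {0..1} \<Longrightarrow> t \<in> {0..1} \<Longrightarrow> d (g i s) (g i t) = \<bar>s - t\<bar>" for i
    unfolding geod_seg_def by metis+
  define l where "l t = g \<lfloor>t\<rfloor> (frac t)" for t
  have frac: "frac t \<in> {0..1}" for t :: real using frac_lt_1[of t] by simp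
  have lX: "l t \<in> X" for t unfolding l_def using g(3) frac by blast
  have left: "d (x \<lfloor>t\<rfloor>) (l t) = frac t" for t
    using g(4)[of 0 "frac t" "\<lfloor>t\<rfloor>"] frac[of t] by (simp add: l_def g(1))
  have right: "d (l t) (x (\<lfloor>t\<rfloor> + 1)) = 1 - frac t" for t
    using g(4)[of "frac t" 1 "\<lfloor>t\<rfloor>"] frac[of t] by (simp add: l_def g(2))
  have le: "d (l s) (l t) = t - s" if "s \<le> t" for s t
  proof (cases "\<lfloor>s\<rfloor> = \<lfloor>t\<rfloor>")
    case True
    then have "d (l s) (l t) = \<bar>frac s - frac t\<bar>"
      using g(4) frac by (simp add: l_def)
    then show ?thesis using True that by (simp add: frac_def)
  next
    case False
    then have less: "\<lfloor>s\<rfloor> + 1 \<le> \<lfloor>t\<rfloor>" using floor_mono[OF that] by simp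
    have "d (l s) (l t) \<le> d (l s) (x (\<lfloor>s\<rfloor> + 1)) + (d (x (\<lfloor>s\<rfloor> + 1)) (x \<lfloor>t\<rfloor>) + d (x \<lfloor>t\<rfloor>) (l t))"
      using triangle[of "l s" "x (\<lfloor>s\<rfloor> + 1)" "l t"] triangle[of "x (\<lfloor>s\<rfloor> + 1)" "x \<lfloor>t\<rfloor>" "l t"] X lX
      by force
    also have "d (x (\<lfloor>s\<rfloor> + 1)) (x \<lfloor>t\<rfloor>) = of_int \<lfloor>t\<rfloor> - of_int \<lfloor>s\<rfloor> - 1"
      using less by (simp add: dist)
    finally have upper: "d (l s) (l t) \<le> t - s" by (simp add: left right frac_def)
    have "d (x \<lfloor>s\<rfloor>) (x (\<lfloor>t\<rfloor> + 1)) \<le> d (x \<lfloor>s\<rfloor>) (l s) + (d (l s) (l t) + d (l t) (x (\<lfloor>t\<rfloor> + 1)))"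
      using triangle[of "x \<lfloor>s\<rfloor>" "l s" "x (\<lfloor>t\<rfloor> + 1)"] triangle[of "l s" "l t" "x (\<lfloor>t\<rfloor> + 1)"] X lX
      by force
    moreover have "d (x \<lfloor>s\<rfloor>) (x (\<lfloor>t\<rfloor> + 1)) = of_int \<lfloor>t\<rfloor> + 1 - of_int \<lfloor>s\<rfloor>"
      using less by (simp add: dist)
    ultimately have "t - s \<le> d (l s) (l t)" by (simp add: left right frac_def)
    with upper show ?thesis by simp
  qed
  have "d (l s) (l t) = \<bar>s - t\<bar>" for s t
    using le[of s t] le[of t s] commute[of "l s" "l t"] by (cases "s \<le> t") auto
  then have "complete_geodesic X d l" using lX by (simp add: complete_geodesic_def)
  moreover have "l (of_int i) = x i" for i by (simp add: l_def g(1))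
  ultimately show ?thesis using that by blast
qed

end

section \<open>Preservation of integer distances\<close>

locale equal_tubes = cat0 X d + D': cat0 X d' for X :: "'a set" and d d' +
  assumes locally_compact: "locally_compact_metric X d"
    and locally_compact': "locally_compact_metric X d'"
    and geodesically_complete: "geodesically_complete X d"
    and geodesically_complete': "geodesically_complete X d'"
    and unit_balls: "x \<in> X \<Longrightarrow> y \<in> X \<Longrightarrow> d x y \<le> 1 \<longleftrightarrow> d' x y \<le> 1"
begin

lemma swap: "equal_tubes X d' d"
  using locally_compact locally_compact' geodesically_complete geodesically_complete' unit_balls
  by (intro equal_tubes.intro equal_tubes_axioms.intro cat0_axioms D'.cat0_axioms) auto

lemma integer_balls_le:
  assumes "x \<in> X" "y \<in> X" "d x y \<le> real n"
  shows "d' x y \<le> real n"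
  using assms(2,3)
proof (induction n arbitrary: y)
  case 0
  then have "d x y = 0" using nonneg[of x y] by simp
  then have "x = y" using zero assms(1) 0 by blast
  then show ?case using 0 by simp
next
  case (Suc n)
  \<comment> \<open>Cutting at this ratio leaves parts of length at most \<open>n\<close> and 1 even
    when \<open>d x y\<close> is less than \<open>Suc n\<close>.\<close>
  define k where "k = real n / real (Suc n)"
  have k: "0 \<le> k" "k \<le> 1" "k * real (Suc n) = real n" "(1 - k) * real (Suc n) = 1"
    by (auto simp: k_def field_simps)
  obtain z where z: "z \<in> X" "d x z = k * d x y" "d z y = (1 - k) * d x y"
    using point_between assms(1) Suc.prems k by metis
  have "d x z \<le> k * real (Suc n)" "d z y \<le> (1 - k) * real (Suc n)"
    unfolding z using mult_left_mono[OF Suc.prems(2)] k(1,2) by simp_all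
  then have "d' x z \<le> real n" "d' z y \<le> 1"
    using Suc.IH[of z] unit_balls[of z y] z Suc.prems k by auto
  then show ?case using D'.triangle[of x z y] assms(1) z Suc.prems by simp
qed

lemma integer_balls: "x \<in> X \<Longrightarrow> y \<in> X \<Longrightarrow> d x y \<le> real n \<longleftrightarrow> d' x y \<le> real n"
  using integer_balls_le equal_tubes.integer_balls_le[OF swap] by blast

text \<open>If the identity were not continuous at \<open>y\<close>, some \<open>d'\<close>-ray from \<open>y\<close>, pointing away from the
  bad sequence, would contain two distinct points \<open>C s\<close> with \<open>d y (C (s + k)) = k + 1\<close> for all
  natural \<open>k\<close>; the \<open>d\<close>-rays from \<open>y\<close> through these points are asymptotic, hence equal.\<close>
lemma identity_continuous:
  assumes y: "y \<in> X" and u: "\<And>n. u n \<in> X" and lim: "(\<lambda>n. d (u n) y) \<longlonglongrightarrow> 0" and "0 < \<epsilon>"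
  shows "\<exists>n. d' (u n) y < \<epsilon>"
proof (rule ccontr)
  assume "\<nexists>n. d' (u n) y < \<epsilon>"
  then have far: "\<epsilon> \<le> d' y (u n)" for n using D'.commute[of y] by (simp add: not_less)
  obtain U K where "openin D'.mtopology U" and K: "compactin D'.mtopology K" "U \<subseteq> K" and "y \<in> U"
    using locally_compact' y unfolding locally_compact_metric_def locally_compact_space_def
    by (metis D'.topspace_mtopology)
  then obtain \<rho> where \<rho>: "\<rho> > 0" "D'.mball y \<rho> \<subseteq> K"
    unfolding D'.openin_mtopology by blast
  \<comment> \<open>Small enough for points at \<open>d'\<close>-distance \<open>e\<close> from
    \<open>y\<close> to lie in the compact set \<open>K\<close> and, by \<open>far\<close>, for each
    segment from \<open>y\<close> to \<open>u n\<close> to contain such a point.\<close>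
  define e where "e = min (\<rho> / 2) (min \<epsilon> 1)"
  have e: "0 < e" "e < \<rho>" "e \<le> \<epsilon>" "e \<le> 1" using \<rho> \<open>0 < \<epsilon>\<close> by (auto simp: e_def)
  define k where "k n = e / d' y (u n)" for n
  have k: "0 \<le> k n" "k n \<le> 1" "k n * d' y (u n) = e" for n
    using far[of n] e by (auto simp: k_def)
  have "\<forall>n. \<exists>m. m \<in> X \<and> d' y m = k n * d' y (u n) \<and> d' m (u n) = (1 - k n) * d' y (u n)"
    using D'.point_between[OF y u k(1,2)] by metis
  then obtain v where v: "v n \<in> X" "d' y (v n) = k n * d' y (u n)"
    "d' (v n) (u n) = (1 - k n) * d' y (u n)" for n by metis
  have ve: "d' y (v n) = e" for n using v(2)[of n] k(3)[of n] by simp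
  have "range v \<subseteq> K" using v(1) ve y e \<rho> by (force simp: D'.mball_def)
  then obtain w r where r: "strict_mono r" and "limitin D'.mtopology (v \<circ> r) w sequentially"
    using K(1) unfolding D'.compactin_sequentially by blast
  then have w: "w \<in> X" and vw: "(\<lambda>n. d' (v (r n)) w) \<longlonglongrightarrow> 0"
    by (auto simp: D'.limitin_metric_dist_null o_def)
  have ur: "(\<lambda>n. d (u (r n)) y) \<longlonglongrightarrow> 0"
    using LIMSEQ_subseq_LIMSEQ[OF lim r] by (simp add: o_def)
  have yw: "d' w y = e"
  proof -
    have "\<bar>e - d' w y\<bar> \<le> d' (v (r n)) w" for n
      using D'.triangle[of y "v (r n)" w] D'.triangle[of y w "v (r n)"] y w v(1)[of "r n"]
        ve[of "r n"] D'.commute[of y w] D'.commute[of w "v (r n)"] by (simp add: abs_le_iff)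
    then have "\<bar>e - d' w y\<bar> \<le> 0"
      using vw by (intro tendsto_lowerbound[OF vw always_eventually]) auto
    then show ?thesis by simp
  qed
  obtain g where g: "geod_seg X d' g w y" using D'.geodesic_exists w y by blast
  \<comment> \<open>The parametrisation puts \<open>w\<close> at \<open>- e\<close> and
    \<open>y\<close> at 0, so the extension beyond \<open>y\<close> leads away from
    \<open>w\<close>, the limit direction of the bad sequence.\<close>
  have "geod_on X d' (\<lambda>t. g (t + e)) (- e) 0"
    using g yw unfolding geod_seg_def geod_on_def by auto
  then obtain C where C: "complete_geodesic X d' C" and agree: "\<forall>t\<in>{- e..0}. C t = g (t + e)"
    using geodesically_complete' e unfolding geodesically_complete_def
    by (metis neg_less_0_iff_less)
  have "C (- e) = w" "C 0 = y" using agree g yw e by (auto simp: geod_seg_def)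
  note C = D'.complete_geodesicD[OF C] this
  \<comment> \<open>\<open>C t\<close> is at distance \<open>t + e\<close> from \<open>w\<close>,
    hence more than \<open>n\<close> from \<open>v (r i)\<close> for large \<open>i\<close>. As
    \<open>y\<close> is within \<open>n\<close> of \<open>C t\<close>, convexity of balls puts
    \<open>u (r i)\<close> outside; this transfers to \<open>d\<close>, where \<open>u (r i)\<close>
    tends to \<open>y\<close>.\<close>
  have far_from_y: "real n \<le> d y (C t)" if t: "t \<le> real n" "real n < t + e" "0 \<le> t" for n t
  proof (rule tendsto_lowerbound)
    show "(\<lambda>i. d y (C t) + d (u (r i)) y) \<longlonglongrightarrow> d y (C t)"
      using tendsto_add[OF tendsto_const ur] by simp
    have "eventually (\<lambda>i. d' (v (r i)) w < t + e - real n) sequentially"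
      using vw t by (intro order_tendstoD) auto
    then show "eventually (\<lambda>i. real n \<le> d y (C t) + d (u (r i)) y) sequentially"
    proof eventually_elim
      case (elim i)
      have "t + e = d' (C t) w" using C(2)[of t "- e"] C(3) t e by simp
      also have "\<dots> \<le> d' (C t) (v (r i)) + d' (v (r i)) w" using D'.triangle C v w by blast
      finally have "real n < d' (C t) (v (r i))" using elim by simp
      moreover have "d' (C t) y \<le> real n" using C(2)[of t 0] C(4) t by simp
      ultimately have "\<not> d' (C t) (u (r i)) \<le> real n"
        using D'.between_le[OF y u C(1) v(1) k(1,2) v(2,3)] by fastforce
      then have "real n < d (C t) (u (r i))" using integer_balls[of "C t" "u (r i)" n] C u by simp
      then show ?case
        using triangle[of "C t" y "u (r i)"] C u y commute[of "C t" y] commute[of "u (r i)" y] by simp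
    qed
  qed auto
  have sphere: "d y (C (s + real k)) = real k + 1" if "1 - e < s" "s \<le> 1" for s k
  proof -
    have "d' y (C (s + real k)) \<le> real (Suc k)" using C(2)[of 0 "s + real k"] C(4) that e by simp
    then have "d y (C (s + real k)) \<le> real (Suc k)" using integer_balls y C by blast
    moreover have "real (Suc k) \<le> d y (C (s + real k))" using that e by (intro far_from_y) auto
    ultimately show ?thesis by simp
  qed
  have step: "d (C s) (C (s + real k)) = real k" if "1 - e < s" "s \<le> 1" for s k
  proof -
    have "d' (C s) (C (s + real k)) \<le> real k" using C(2) by simp
    then have "d (C s) (C (s + real k)) \<le> real k" using integer_balls C by blast
    moreover have "d y (C (s + real k)) \<le> d y (C s) + d (C s) (C (s + real k))"
      using triangle y C by blast
    ultimately show ?thesis using sphere[of s 0] sphere[of s k] that by simp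
  qed
  \<comment> \<open>Besides 1, a second parameter in the range where \<open>sphere\<close> and
    \<open>step\<close> hold.\<close>
  define s where "s = 1 - e / 2"
  have s: "1 - e < s" "s \<le> 1" using e by (auto simp: s_def)
  have one: "1 - e < 1" "(1::real) \<le> 1" using e by auto
  have "d (C s) (C 1) \<le> 1 / (real k + 1)" for k
  proof (rule diverging_segments[of y "C 1" "C (1 + real k)" "C s" "C (s + real k)"])
    have "d' (C (1 + real k)) (C (s + real k)) \<le> 1" using C(2) e by (simp add: s_def)
    then show "d (C (1 + real k)) (C (s + real k)) \<le> 1" using unit_balls C by blast
  qed (use y C(1) step[OF one, of k] step[OF s, of k] sphere[OF one, of k] sphere[OF one, of 0]
      sphere[OF s, of k] sphere[OF s, of 0] in auto)
  moreover have "(\<lambda>k. 1 / (real k + 1)) \<longlonglongrightarrow> 0"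
    using LIMSEQ_inverse_real_of_nat by (simp add: inverse_eq_divide add.commute)
  ultimately have "d (C s) (C 1) \<le> 0"
    by (intro tendsto_lowerbound[OF _ always_eventually]) auto
  then have "d (C s) (C 1) = 0" using nonneg[of "C s" "C 1"] by simp
  then have "C s = C 1" using C(1) zero by blast
  then show False using C(2)[of s 1] C(1)[of 1] e by (simp add: s_def)
qed

text \<open>Only \<open>d' x y < n\<close> has to be excluded. Extending the
  \<open>d\<close>-segment beyond \<open>y\<close> gives points outside the ball of radius
  \<open>n\<close> about \<open>x\<close>, for both metrics, and by continuity some of them are
  \<open>d'\<close>-close to \<open>y\<close>.\<close>

lemma integer_spheres:
  assumes x: "x \<in> X" and y: "y \<in> X" and xy: "d x y = real n"
  shows "d' x y = real n"
proof (rule ccontr)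
  assume "d' x y \<noteq> real n"
  moreover have "d' x y \<le> real n" using integer_balls[OF x y, of n] xy by simp
  ultimately have less: "d' x y < real n" by simp
  then have n: "0 < real n" using D'.nonneg[of x y] by linarith
  obtain g where g: "geod_seg X d g x y" using geodesic_exists x y by blast
  then have "geod_on X d g 0 (real n)" unfolding geod_seg_def geod_on_def xy by auto
  then obtain C where C: "complete_geodesic X d C" and "\<forall>t\<in>{0..real n}. C t = g t"
    using geodesically_complete n unfolding geodesically_complete_def by blast
  then have ends: "C 0 = x" "C (real n) = y" using g n by (auto simp: geod_seg_def xy)
  define u where "u i = C (real n + 1 / (real i + 1))" for i
  have "d (u i) y = 1 / (real i + 1)" for i
    using complete_geodesic_dist[OF C, of "real n + 1 / (real i + 1)" "real n"] ends by (simp add: u_def)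
  moreover have "(\<lambda>i. 1 / (real i + 1)) \<longlonglongrightarrow> 0"
    using LIMSEQ_inverse_real_of_nat by (simp add: inverse_eq_divide add.commute)
  ultimately have "(\<lambda>i. d (u i) y) \<longlonglongrightarrow> 0" by simp
  moreover have uX: "u i \<in> X" for i using complete_geodesic_mem C by (simp add: u_def)
  ultimately obtain i where i: "d' (u i) y < real n - d' x y"
    using identity_continuous[OF y] less by (metis diff_gt_0_iff_gt)
  have "d x (u i) = real n + 1 / (real i + 1)"
    using complete_geodesic_dist[OF C, of "real n + 1 / (real i + 1)" 0] ends n
    by (simp add: u_def commute[of x])
  then have "\<not> d x (u i) \<le> real n" by simp
  then have "real n < d' x (u i)" using integer_balls[OF x uX] by auto
  also have "\<dots> \<le> d' x y + d' (u i) y" using D'.triangle[OF x y uX, of i] D'.commute[of y "u i"] by simp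
  finally show False using i by simp
qed

lemma integer_isometry:
  assumes l: "complete_geodesic X d l"
  shows "d' (l (of_int i)) (l (of_int j)) = \<bar>of_int i - of_int j\<bar>"
proof -
  have "d (l (of_int i)) (l (of_int j)) = real (nat \<bar>i - j\<bar>)"
    using complete_geodesic_dist[OF l] by simp
  from integer_spheres[OF complete_geodesic_mem[OF l] complete_geodesic_mem[OF l] this]
  show ?thesis by simp
qed

lemma integer_line_extends':
  assumes l: "complete_geodesic X d l"
  obtains l' where "complete_geodesic X d' l'" "\<And>i. l' (of_int i) = l (of_int i)"
  using D'.integer_line_extends[of "\<lambda>i. l (of_int i)"] integer_isometry complete_geodesic_mem l by metis

section \<open>Transfer of parallel lines\<close>

context
  fixes c c'
  assumes c: "complete_geodesic X d c" and c': "complete_geodesic X d' c'"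
    and agree: "\<And>i. c' (of_int i) = c (of_int i)"
begin

lemma parallel_transfer:
  assumes "parallel c l"
  obtains l' where "D'.parallel c' l'" "\<And>i. l' (of_int i) = l (of_int i)"
proof -
  obtain B where B: "\<And>t. d (l t) (c t) \<le> B" and l: "complete_geodesic X d l"
    using assms by (auto simp: parallel_def)
  obtain l' where l': "complete_geodesic X d' l'" "\<And>i. l' (of_int i) = l (of_int i)"
    using integer_line_extends' l by blast
  \<comment> \<open>The bound is rounded up to transfer at integer parameters; the
    \<open>+ 2\<close> below pays for the distances from \<open>t\<close> to its floor on both
    lines.\<close>
  define N where "N = nat \<lceil>B\<rceil>"
  have "d (l t) (c t) \<le> real N" for t using B[of t] unfolding N_def by linarith
  then have N: "d' (l' (of_int i)) (c' (of_int i)) \<le> real N" for i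
    unfolding agree l'(2) using integer_balls complete_geodesic_mem l c by blast
  have "d' (l' t) (c' t) \<le> real N + 2" for t
  proof -
    let ?s = "of_int \<lfloor>t\<rfloor>"
    have "d' (l' t) (c' t) \<le> d' (l' t) (l' ?s) + (d' (l' ?s) (c' ?s) + d' (c' ?s) (c' t))"
      using D'.triangle[of "l' t" "l' ?s" "c' t"] D'.triangle[of "l' ?s" "c' ?s" "c' t"]
        D'.complete_geodesic_mem l'(1) c' by force
    moreover have "d' (l' t) (l' ?s) \<le> 1" "d' (c' ?s) (c' t) \<le> 1"
      unfolding D'.complete_geodesic_dist[OF l'(1)] D'.complete_geodesic_dist[OF c'] by linarith+
    ultimately show ?thesis using N[of "\<lfloor>t\<rfloor>"] by linarith
  qed
  then have "D'.parallel c' l'" using l' by (auto simp: D'.parallel_def)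
  then show ?thesis using that l' by blast
qed

text \<open>A line carries over only at integer parameters, which is enough for its starting point
  and its unit translate.\<close>

lemma parallel_set_transfer:
  assumes p: "p \<in> parallel_set c"
  shows "p \<in> D'.parallel_set c'" "line_through c p 1 = D'.line_through c' p 1"
proof -
  note l = line_through[OF c p]
  obtain l' where l': "D'.parallel c' l'" "\<And>i. l' (of_int i) = line_through c p (of_int i)"
    using parallel_transfer l by blast
  have p': "l' 0 = p" using l'(2)[of 0] l by simp
  then show "p \<in> D'.parallel_set c'" using D'.parallel_mem[OF c' l'(1), of 0] by simp
  show "line_through c p 1 = D'.line_through c' p 1"
    using D'.line_through_eq[OF c' l'(1)] p' l'(2)[of 1] by simp
qed

end

lemma isometric_on_parallel_set:
  assumes c: "complete_geodesic X d c"
    and u: "u \<in> parallel_set c" and v: "v \<in> parallel_set c" and uv: "transversal c u v > 0"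
    and p: "p \<in> parallel_set c" and q: "q \<in> parallel_set c"
  shows "d' p q = d p q"
proof -
  obtain c' where c': "complete_geodesic X d' c'" and agree: "\<And>i. c' (of_int i) = c (of_int i)"
    using integer_line_extends' c by blast
  have P: "D'.parallel_set c' = parallel_set c"
    using parallel_set_transfer(1)[OF c c' agree]
      equal_tubes.parallel_set_transfer(1)[OF swap c' c agree[symmetric]] by blast
  interpret two_line_products "parallel_set c" "\<lambda>s p. line_through c p s" "height c" "transversal c"
    "\<lambda>s p. D'.line_through c' p s" "D'.height c'" "D'.transversal c'"
  proof (intro two_line_products.intro two_line_products_axioms.intro)
    show "line_product (parallel_set c) (\<lambda>s p. line_through c p s) (height c) (transversal c)"
      using line_product_parallel_set c by blast
    show "line_product (parallel_set c) (\<lambda>s p. D'.line_through c' p s) (D'.height c') (D'.transversal c')"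
      using D'.line_product_parallel_set c' P by metis
    show "line_through c p 1 = D'.line_through c' p 1" if "p \<in> parallel_set c" for p
      using parallel_set_transfer(2)[OF c c' agree that] .
    show "(height c p - height c q)\<^sup>2 + (transversal c p q)\<^sup>2 \<le> (real n)\<^sup>2 \<longleftrightarrow>
        (D'.height c' p - D'.height c' q)\<^sup>2 + (D'.transversal c' p q)\<^sup>2 \<le> (real n)\<^sup>2"
      if p: "p \<in> parallel_set c" and q: "q \<in> parallel_set c" for p q n
    proof -
      have "p \<in> X" "q \<in> X" using parallel_set_subset[OF c] p q by auto
      then have "(d p q)\<^sup>2 \<le> (real n)\<^sup>2 \<longleftrightarrow> (d' p q)\<^sup>2 \<le> (real n)\<^sup>2"
        using integer_balls[of p q n] by (simp add: abs_le_square_iff[symmetric])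
      then show ?thesis
        using parallel_set_dist[OF c p q] D'.parallel_set_dist[OF c'] p q P by simp
    qed
  qed
  have "(d' p q)\<^sup>2 = (d p q)\<^sup>2"
    using parallel_set_dist[OF c p q] D'.parallel_set_dist[OF c'] p q P same_metric[OF u v uv p q] by simp
  then show ?thesis by (simp add: power2_eq_iff_nonneg)
qed

end

section \<open>The flat strip inside the parallel set of its boundary line\<close>

theorem theorem4:
  fixes X :: "'a set" and d d' :: "'a \<Rightarrow> 'a \<Rightarrow> real" and c :: "real \<Rightarrow> 'a"
  assumes "CAT0 X d" and "locally_compact_metric X d" and "geodesically_complete X d"
    and "connected_at_infinity X d"
    and "CAT0 X d'" and "locally_compact_metric X d'" and "geodesically_complete X d'"
    and "\<forall>x\<in>X. \<forall>y\<in>X. d x y \<le> 1 \<longleftrightarrow> d' x y \<le> 1"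
    and "complete_geodesic X d c" and "bounds_flat_strip X d c"
  shows "complete_geodesic X d' c \<and> bounds_flat_strip X d' c \<and>
         (\<forall>t1 t2. d' (c t1) (c t2) = d (c t1) (c t2))"
proof -
  have "Metric_space X d" "Metric_space X d'"
    using assms(1,5) by (auto simp: CAT0_def geodesic_space_def)
  then interpret equal_tubes X d d'
    using assms by (intro equal_tubes.intro cat0.intro cat0_axioms.intro equal_tubes_axioms.intro) auto
  note c = \<open>complete_geodesic X d c\<close>
  obtain w and f :: "real \<times> real \<Rightarrow> 'a" where w: "w > 0" and "\<forall>p\<in>UNIV \<times> {0..w}. f p \<in> X"
    and "\<forall>p\<in>UNIV \<times> {0..w}. \<forall>q\<in>UNIV \<times> {0..w}. d (f p) (f q) = dist p q"
    and range: "range c = range (\<lambda>t. f (t, 0)) \<or> range c = range (\<lambda>t. f (t, w))"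
    using assms(10) unfolding bounds_flat_strip_def by blast
  then have fX: "f (s, h) \<in> X" if "h \<in> {0..w}" for s h using that by simp
  have fd: "d (f (s, h)) (f (t, k)) = dist (s, h) (t, k)" if "h \<in> {0..w}" "k \<in> {0..w}" for s h t k
    using that \<open>\<forall>p\<in>UNIV \<times> {0..w}. \<forall>q\<in>UNIV \<times> {0..w}. d (f p) (f q) = dist p q\<close> by simp
  \<comment> \<open>The witness is 0 or \<open>w\<close>; thus both choices of the boundary line are
    treated at once.\<close>
  obtain h0 where h0: "h0 \<in> {0..w}" and range0: "range c = range (\<lambda>t. f (t, h0))"
    using range w by (metis atLeastAtMost_iff less_imp_le order_refl)
  have "\<forall>t. \<exists>s. c t = f (s, h0)" using range0 by (metis (mono_tags, lifting) image_iff rangeI)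
  \<comment> \<open>\<open>c\<close> need not be parametrised like the strip;
    \<open>\<sigma>\<close> is the change of parameter.\<close>
  then obtain \<sigma> where \<sigma>: "\<And>t. c t = f (\<sigma> t, h0)" by metis
  have \<sigma>_isometry: "\<bar>\<sigma> s - \<sigma> t\<bar> = \<bar>s - t\<bar>" for s t
    using fd[OF h0 h0, of "\<sigma> s" "\<sigma> t"] complete_geodesic_dist[OF c, of s t] \<sigma>
    by (simp add: dist_Pair_Pair dist_real_def)
  have line: "parallel c (\<lambda>t. f (\<sigma> t, h))" if h: "h \<in> {0..w}" for h
    unfolding parallel_def
  proof (intro conjI exI allI)
    show "complete_geodesic X d (\<lambda>t. f (\<sigma> t, h))"
      unfolding complete_geodesic_def
      using fX[OF h] fd[OF h h] \<sigma>_isometry by (simp add: dist_Pair_Pair dist_real_def)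
    show "d (f (\<sigma> t, h)) (c t) \<le> \<bar>h - h0\<bar>" for t
      using fd[OF h h0] \<sigma> by (simp add: dist_Pair_Pair dist_real_def)
  qed
  have mem: "f (s, h) \<in> parallel_set c" if h: "h \<in> {0..w}" for s h
  proof -
    obtain t where "f (s, h0) = c t" using range0 by (metis rangeE rangeI)
    then have "d (f (s, h0)) (f (\<sigma> t, h0)) = 0" using \<sigma> fX[OF h0] by simp
    then have "s = \<sigma> t" using fd[OF h0 h0] by simp
    then show ?thesis using parallel_mem[OF c line[OF h], of t] by simp
  qed
  have thick: "transversal c (f (\<sigma> 0, 0)) (f (\<sigma> 0, w)) > 0"
  proof -
    let ?p = "f (\<sigma> 0, 0)" and ?q = "f (\<sigma> 0, w)"
    have ends: "0 \<in> {0..w}" "w \<in> {0..w}" using w by auto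
    have "height c ?p = height c ?q"
    proof -
      \<comment> \<open>The contribution of \<open>h - h0\<close> cancels, so all points
        \<open>f (\<sigma> 0, h)\<close> have the same height.\<close>
      have "(d (c 0) (f (\<sigma> 0, h)))\<^sup>2 - (d (c 1) (f (\<sigma> 0, h)))\<^sup>2 = - (\<sigma> 1 - \<sigma> 0)\<^sup>2" if h: "h \<in> {0..w}" for h
        using fd[OF h0 h] \<sigma> by (simp add: dist_Pair_Pair dist_real_def)
      from this[OF ends(1)] this[OF ends(2)] show ?thesis by (simp add: height_def)
    qed
    moreover have "d ?p ?q = w" using fd[OF ends] w by (simp add: dist_Pair_Pair dist_real_def)
    ultimately show ?thesis using w by (simp add: transversal_def)
  qed
  have iso: "d' p q = d p q" if "p \<in> parallel_set c" "q \<in> parallel_set c" for p q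
    using isometric_on_parallel_set[OF c mem mem thick that] w by simp
  have c_mem: "c t \<in> parallel_set c" for t using parallel_mem[OF c parallel_self[OF c]] .
  have "complete_geodesic X d' c" using c iso[OF c_mem c_mem] by (simp add: complete_geodesic_def)
  moreover have "bounds_flat_strip X d' c"
    unfolding bounds_flat_strip_def
  proof (intro conjI exI[of _ w] exI[of _ f])
    show "\<forall>p\<in>UNIV \<times> {0..w}. \<forall>q\<in>UNIV \<times> {0..w}. d' (f p) (f q) = dist p q"
      using iso[OF mem mem] fd by auto
  qed (use calculation w fX range in auto)
  ultimately show ?thesis using iso[OF c_mem c_mem] by blast
qed

end
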